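(* Let $d,n\in\mathbb{N}$ and $k$ vary with $n\to\infty$ so that $d\ll\log n$ and $k-d\asymp k$. Then, with convergence uniform over all Abelian groups $G$ with $|G|=n$ and $d(G)=d$, $$\max_{L\in\mathbb{N}} t_0\bigl(L,|G/LG|\bigr)\sim t_0(\infty,|G|).$$
   Context: Asymptotic notation: $a\ll b$ means $a/b\to0$; $a\asymp b$ means $a/b$ is bounded above and below by positive constants; $a\sim b$ means $a/b\to1$. For a finite Abelian group $G$ (written additively), $d(G)$ is the minimal size of a generating subset of $G$ and $LG:=\{Lx:x\in G\}$. The walk is either the rate-1 simple random walk (jumps $\pm1$ with probability $1/2$ each) or the rate-1 directed random walk (jumps $+1$), started at $0$, on $\mathbb{Z}_L$ (jumps taken mod $L$), or on $\mathbb{Z}$ when $L=\infty$. $H_L(s)$ is the Shannon entropy (natural logarithm) of its position at time $s$; for $2\le L\le\infty$, $H_L$ is a strictly increasing bijection from $[0,\infty)$ to $[0,\log L)$ (to $[0,\infty)$ if $L=\infty$). For $L\in\mathbb{N}\cup\{\infty\}$ and $N\in\mathbb{N}$ the entropic time (with $k$ coordinates) is $$t_0(L,N):=k\,H_L^{-1}\bigl((\log N)/k\bigr).$$ The trivial case $L=1$ (where $H_1\equiv0$ and $|G/LG|=1$) is given the value $0$. The statement holds for both walks. *)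

theory Defs
  imports "HOL-Probability.Probability" "HOL-Algebra.Algebra" "HOL-Library.Extended_Nat"
begin

text \<open>
  Sequences indexed by \<^typ>\<open>nat\<close>. The ratio itself, not its absolute value, has to be bounded by
  positive constants, so this is not the Landau symbol Theta.
\<close>

definition same_order :: "(nat \<Rightarrow> real) \<Rightarrow> (nat \<Rightarrow> real) \<Rightarrow> bool"
  where "same_order a b \<longleftrightarrow>
    (\<exists>c>0. \<exists>C>0. \<forall>\<^sub>F j in sequentially. c \<le> a j / b j \<and> a j / b j \<le> C)"

text \<open>
  Groups are written multiplicatively, so the multiple \<open>L x\<close> of additive notation is the
  power \<open>x [^] L\<close>.
\<close>

definition multiples :: "nat \<Rightarrow> ('a, 'b) monoid_scheme \<Rightarrow> 'a set"
  where "multiples L G = (\<lambda>x. x [^]\<^bsub>G\<^esub> L) ` carrier G"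

definition min_generators :: "('a, 'b) monoid_scheme \<Rightarrow> nat"
  where "min_generators G =
    (LEAST m. \<exists>S. S \<subseteq> carrier G \<and> finite S \<and> card S = m \<and> generate G S = carrier G)"

datatype walk = Simple | Directed

primrec jump_pmf :: "walk \<Rightarrow> int pmf"
  where
    "jump_pmf Simple = pmf_of_set {-1, 1}"
  | "jump_pmf Directed = return_pmf 1"

text \<open>
  The cyclic group of order \<open>L\<close> is represented by the residues \<open>{0..<L}\<close>; for \<open>L = \<infinity>\<close> the walk
  lives on the integers.
\<close>

definition reduce :: "enat \<Rightarrow> int \<Rightarrow> int"
  where "reduce L x = (case L of enat l \<Rightarrow> x mod int l | \<infinity> \<Rightarrow> x)"

primrec jump_chain :: "walk \<Rightarrow> enat \<Rightarrow> nat \<Rightarrow> int pmf"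
  where
    "jump_chain w L 0 = return_pmf 0"
  | "jump_chain w L (Suc m) =
      bind_pmf (jump_chain w L m) (\<lambda>x. map_pmf (\<lambda>z. reduce L (x + z)) (jump_pmf w))"

text \<open>
  The number of jumps of a rate-1 walk up to time \<open>s\<close> is Poisson distributed with mean \<open>s\<close>. The
  library's \<^const>\<open>poisson_pmf\<close> is specified for positive rates only, hence the case distinction.
\<close>

definition jump_count :: "real \<Rightarrow> nat pmf"
  where "jump_count s = (if s > 0 then poisson_pmf s else return_pmf 0)"

definition walk_law :: "walk \<Rightarrow> enat \<Rightarrow> real \<Rightarrow> int pmf"
  where "walk_law w L s = bind_pmf (jump_count s) (jump_chain w L)"

definition shannon_entropy :: "int pmf \<Rightarrow> real"
  where "shannon_entropy p =
    prob_space.entropy (measure_pmf p) (exp 1) (count_space UNIV) (\<lambda>x. x)"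

lemma shannon_entropy_eq:
  "shannon_entropy p = - (\<integral>x. pmf p x * ln (pmf p x) \<partial>count_space UNIV)"
proof -
  interpret information_space "measure_pmf p" "exp 1"
    by (intro information_space.intro information_space_axioms.intro)
      (auto intro: prob_space_measure_pmf)
  have d: "distr (measure_pmf p) (count_space UNIV) (\<lambda>x. x) = measure_pmf p"
    by (intro measure_eqI) (auto simp: emeasure_distr)
  have "distributed (measure_pmf p) (count_space UNIV) (\<lambda>x. x) (\<lambda>x. ennreal (pmf p x))"
    unfolding distributed_def d by (auto simp: measure_pmf_eq_density)
  from entropy_distr[OF this] show ?thesis
    unfolding shannon_entropy_def by (simp add: log_def)
qed

definition walk_entropy :: "walk \<Rightarrow> enat \<Rightarrow> real \<Rightarrow> real"
  where "walk_entropy w L s = shannon_entropy (walk_law w L s)"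

text \<open>
  For \<open>2 \<le> L\<close> the entropy is a bijection from \<open>{0..}\<close> onto \<open>{0..<ln L}\<close> (onto \<open>{0..}\<close> if
  \<open>L = \<infinity>\<close>); the value is meaningful only if \<open>ln N / k\<close> lies in that range.
\<close>

definition entropic_time :: "walk \<Rightarrow> nat \<Rightarrow> enat \<Rightarrow> nat \<Rightarrow> real"
  where "entropic_time w k L N =
    (if L = 1 then 0 else real k * inv_into {0..} (walk_entropy w L) (ln (real N) / real k))"

end

theory Submission
  imports Defs "HOL-Real_Asymp.Real_Asymp"
begin

text \<open>
  Write \<open>H\<^sub>L\<close> for the entropy of the walk on the cycle of length \<open>L\<close>, \<open>H\<close> for the entropy of the walk
  on the integers, and \<open>N\<^sub>L\<close> for the order of \<open>G / L G\<close>.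

  The maximum is at least \<open>t\<^sub>0(\<infinity>, n)\<close>: at \<open>L = n\<close> the quotient is all of \<open>G\<close>, and reducing the walk
  modulo \<open>n\<close> can only lose entropy, so that \<open>H\<^sub>n\<close> needs at least as much time as \<open>H\<close> to reach a given
  level. The maximum is attained because \<open>L G = gcd(L, n) G\<close>, and replacing \<open>L\<close> by its divisor
  \<open>gcd(L, n)\<close> lowers the entropy and hence raises the time. Only divisors of \<open>n\<close> matter.

  For the upper bound let \<open>s\<close> be the time with \<open>H(s) = x = ln n / k\<close>. All that is used about the group is
  that \<open>N\<^sub>L\<close> is bounded by \<open>n\<close> and by \<open>L\<^sup>d\<close>. So the level \<open>ln N\<^sub>L / k\<close> that \<open>H\<^sub>L\<close> has to reach is at most
  \<open>x\<close>, at most \<open>(1 - c) ln L\<close> since \<open>d \<le> (1 - c) k\<close>, and at most \<open>\<eta> x ln L\<close> for any fixed \<open>\<eta> > 0\<close>, since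
  \<open>d\<close> is small compared with \<open>ln n\<close>. The heart of the proof is \<open>walk_entropy_comparison\<close>: for a suitable
  \<open>\<eta>\<close>, one of these three levels is reached by \<open>H\<^sub>L\<close> at time \<open>(1 + e) s\<close>, uniformly in \<open>L \<ge> 2\<close> and
  \<open>s > 0\<close>. Its proof distinguishes regimes. For small \<open>s\<close> both entropies behave like \<open>s ln (1 / s)\<close>. If
  \<open>L\<close> is large compared with the diffusive scale \<open>sqrt s\<close>, then \<open>H\<^sub>L\<close> is close to \<open>H\<close>
  (\<open>walk_entropy_infinity_le_cycle\<close>), while the factor \<open>1 + e\<close> in time raises \<open>H\<close> by a fixed amount
  (\<open>walk_entropy_infinity_gap\<close>). If \<open>L\<close> is at most of order \<open>sqrt s\<close>, then \<open>H\<^sub>L\<close> is within a constant of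
  its maximum \<open>ln L\<close> (\<open>walk_entropy_diffusive_ge\<close>), which suffices for large \<open>L\<close>; finitely many \<open>L\<close>
  remain, treated by convergence to equilibrium for large \<open>s\<close> and by the choice of \<open>\<eta>\<close> for moderate \<open>s\<close>.

  The tool behind strict monotonicity and behind the quantitative increase of the entropy is
  \<open>walk_entropy_increment\<close>. The law at time \<open>s + t\<close> is a mixture of translates of the law at time \<open>s\<close>;
  the gain of entropy is the average relative entropy of these translates with respect to the
  mixture, and relative entropy is bounded below by the squared difference of the expectations of any
  function of modulus at most 1. Taking a character as this function gives an explicit bound,
  uniform in \<open>L\<close>.
\<close>

section \<open>Relative entropy and mixtures\<close>

lemma shannon_entropy_expectation:
  "shannon_entropy p = measure_pmf.expectation p (\<lambda>x. - ln (pmf p x))"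
  unfolding shannon_entropy_eq measure_pmf_eq_density
  by (subst integral_density) (auto simp: pmf_nonneg simp flip: Bochner_Integration.integral_minus)

lemma shannon_entropy_sum:
  assumes "finite A" "set_pmf p \<subseteq> A"
  shows "shannon_entropy p = (\<Sum>x\<in>A. - (pmf p x * ln (pmf p x)))"
  unfolding shannon_entropy_expectation
  by (subst integral_measure_pmf[OF assms(1)]) (use assms in auto)

text \<open>
  Summed over a probability space, the terms \<open>b - a\<close> cancel and this bounds the squared Hellinger
  distance by the relative entropy. It is \<open>ln z \<le> z - 1\<close> at \<open>z = sqrt (b / a)\<close>.
\<close>

lemma hellinger_le_relative_entropy:
  fixes a b :: real
  assumes "a \<ge> 0" "b > 0"
  shows "a + b - 2 * (sqrt a * sqrt b) \<le> a * (ln a - ln b) + b - a"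
proof (cases "a = 0")
  case False
  with assms have a: "a > 0" by simp
  have "ln (sqrt b / sqrt a) \<le> sqrt b / sqrt a - 1"
    using a assms by (intro ln_le_minus_one) auto
  also have "ln (sqrt b / sqrt a) = (ln b - ln a) / 2"
    using a assms by (simp add: ln_div ln_sqrt)
  finally have "a * ((ln b - ln a) / 2) \<le> a * (sqrt b / sqrt a - 1)"
    using a by (intro mult_left_mono) auto
  also have "a * (sqrt b / sqrt a - 1) = sqrt a * sqrt b - a"
  proof -
    have "a = sqrt a * sqrt a" using a by simp
    then have "a * (sqrt b / sqrt a) = sqrt a * sqrt b"
      using a by (metis (no_types, lifting) less_irrefl mult.assoc mult.commute nonzero_mult_div_cancel_left real_sqrt_eq_zero_cancel_iff times_divide_eq_right)
    then show ?thesis by (simp add: right_diff_distrib)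
  qed
  finally have "a * (ln b - ln a) / 2 \<le> sqrt a * sqrt b - a" by simp
  then show ?thesis by (simp add: right_diff_distrib)
qed (use assms in auto)

text \<open>
  Gibbs' inequality with a quantitative error: by Cauchy-Schwarz the difference of the two
  expectations, written with \<open>p - m = (sqrt p - sqrt m) (sqrt p + sqrt m)\<close>, is at most twice the
  Hellinger distance, whose square is bounded by the relative entropy.
\<close>

lemma cross_entropy_ge:
  fixes p m :: "int pmf" and f :: "int \<Rightarrow> complex"
  assumes fin: "finite (set_pmf m)" and sub: "set_pmf p \<subseteq> set_pmf m"
    and f: "\<And>x. cmod (f x) \<le> 1"
  shows "shannon_entropy p + (cmod (measure_pmf.expectation p f - measure_pmf.expectation m f))\<^sup>2 / 4
    \<le> measure_pmf.expectation p (\<lambda>x. - ln (pmf m x))"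
proof -
  let ?A = "set_pmf m"
  define r where "r x = sqrt (pmf p x)" for x
  define q where "q x = sqrt (pmf m x)" for x
  have sp: "(\<Sum>x\<in>?A. pmf p x) = 1" using fin sub by (intro sum_pmf_eq_1) auto
  have sm: "(\<Sum>x\<in>?A. pmf m x) = 1" using fin by (intro sum_pmf_eq_1) auto
  have r2: "(r x)\<^sup>2 = pmf p x" and q2: "(q x)\<^sup>2 = pmf m x" for x by (simp_all add: r_def q_def)
  have "measure_pmf.expectation p f - measure_pmf.expectation m f
      = (\<Sum>x\<in>?A. (pmf p x - pmf m x) *\<^sub>R f x)"
    using fin sub by (subst (1 2) integral_measure_pmf[of ?A])
      (auto simp: sum_subtractf scaleR_diff_left)
  also have "cmod \<dots> \<le> (\<Sum>x\<in>?A. \<bar>r x - q x\<bar> * \<bar>r x + q x\<bar>)"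
  proof (rule sum_norm_le)
    fix x
    have "pmf p x - pmf m x = (r x - q x) * (r x + q x)"
      unfolding r2[symmetric] q2[symmetric] by (simp add: algebra_simps power2_eq_square)
    then have "cmod ((pmf p x - pmf m x) *\<^sub>R f x) = \<bar>r x - q x\<bar> * \<bar>r x + q x\<bar> * cmod (f x)"
      by (simp add: abs_mult)
    also have "\<dots> \<le> \<bar>r x - q x\<bar> * \<bar>r x + q x\<bar>" using f[of x] by (intro mult_left_le) auto
    finally show "cmod ((pmf p x - pmf m x) *\<^sub>R f x) \<le> \<bar>r x - q x\<bar> * \<bar>r x + q x\<bar>" .
  qed
  finally have "(cmod (measure_pmf.expectation p f - measure_pmf.expectation m f))\<^sup>2
      \<le> (\<Sum>x\<in>?A. \<bar>r x - q x\<bar> * \<bar>r x + q x\<bar>)\<^sup>2"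
    by (intro power_mono) auto
  also have "\<dots> \<le> (\<Sum>x\<in>?A. (r x - q x)\<^sup>2) * (\<Sum>x\<in>?A. (r x + q x)\<^sup>2)"
    using Cauchy_Schwarz_ineq_sum[of "\<lambda>x. \<bar>r x - q x\<bar>" "\<lambda>x. \<bar>r x + q x\<bar>" ?A] by simp
  also have "\<dots> \<le> (\<Sum>x\<in>?A. (r x - q x)\<^sup>2) * 4"
  proof (intro mult_left_mono sum_nonneg)
    have "(\<Sum>x\<in>?A. (r x + q x)\<^sup>2) \<le> (\<Sum>x\<in>?A. 2 * pmf p x + 2 * pmf m x)"
    proof (rule sum_mono)
      fix x
      have "0 \<le> (r x - q x)\<^sup>2" by simp
      then show "(r x + q x)\<^sup>2 \<le> 2 * pmf p x + 2 * pmf m x"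
        unfolding r2[symmetric] q2[symmetric] power2_sum power2_diff by simp
    qed
    then show "(\<Sum>x\<in>?A. (r x + q x)\<^sup>2) \<le> 4" by (simp add: sum.distrib sp sm flip: sum_distrib_left)
  qed auto
  also have "(\<Sum>x\<in>?A. (r x - q x)\<^sup>2) \<le> (\<Sum>x\<in>?A. pmf p x * (ln (pmf p x) - ln (pmf m x)) + pmf m x - pmf p x)"
  proof (rule sum_mono)
    fix x assume "x \<in> ?A"
    then have "pmf m x > 0" by (simp add: pmf_positive)
    from hellinger_le_relative_entropy[OF pmf_nonneg[of p x] this]
    show "(r x - q x)\<^sup>2 \<le> pmf p x * (ln (pmf p x) - ln (pmf m x)) + pmf m x - pmf p x"
      unfolding power2_diff r2 q2 by (simp add: r_def q_def)
  qed
  also have "\<dots> = (\<Sum>x\<in>?A. pmf p x * (ln (pmf p x) - ln (pmf m x)))"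
    by (simp add: sum.distrib sum_subtractf sp sm)
  also have "\<dots> = measure_pmf.expectation p (\<lambda>x. - ln (pmf m x)) - shannon_entropy p"
    using fin sub by (subst integral_measure_pmf[of ?A])
      (auto simp: shannon_entropy_sum[of ?A] sum_subtractf right_diff_distrib sum_negf)
  finally show ?thesis by simp
qed

text \<open>
  The entropy of a mixture is the average over \<open>Q\<close> of the cross entropies of the components with
  respect to the mixture, so the previous bound can be averaged.
\<close>

lemma entropy_mixture_ge:
  fixes Q :: "int pmf" and K :: "int \<Rightarrow> int pmf" and f :: "int \<Rightarrow> complex"
  assumes fQ: "finite (set_pmf Q)" and fK: "\<And>y. y \<in> set_pmf Q \<Longrightarrow> finite (set_pmf (K y))"
    and f: "\<And>x. cmod (f x) \<le> 1"
  shows "measure_pmf.expectation Q (\<lambda>y. shannon_entropy (K y)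
      + (cmod (measure_pmf.expectation (K y) f - measure_pmf.expectation (bind_pmf Q K) f))\<^sup>2 / 4)
    \<le> shannon_entropy (bind_pmf Q K)"
proof -
  let ?M = "bind_pmf Q K"
  have "measure_pmf.expectation Q (\<lambda>y. shannon_entropy (K y)
      + (cmod (measure_pmf.expectation (K y) f - measure_pmf.expectation ?M f))\<^sup>2 / 4)
     \<le> measure_pmf.expectation Q (\<lambda>y. measure_pmf.expectation (K y) (\<lambda>x. - ln (pmf ?M x)))"
  proof (rule integral_mono_AE)
    show "AE y in measure_pmf Q. shannon_entropy (K y)
      + (cmod (measure_pmf.expectation (K y) f - measure_pmf.expectation ?M f))\<^sup>2 / 4
      \<le> measure_pmf.expectation (K y) (\<lambda>x. - ln (pmf ?M x))"
    proof (rule AE_pmfI)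
      fix y assume "y \<in> set_pmf Q"
      then show "shannon_entropy (K y)
        + (cmod (measure_pmf.expectation (K y) f - measure_pmf.expectation ?M f))\<^sup>2 / 4
        \<le> measure_pmf.expectation (K y) (\<lambda>x. - ln (pmf ?M x))"
        using fQ fK f by (intro cross_entropy_ge) (auto simp: set_bind_pmf)
    qed
  qed (intro integrable_measure_pmf_finite fQ)+
  also have "\<dots> = (\<Sum>y\<in>set_pmf Q. pmf Q y *\<^sub>R measure_pmf.expectation (K y) (\<lambda>x. - ln (pmf ?M x)))"
    by (rule integral_measure_pmf) (use fQ in auto)
  also have "\<dots> = measure_pmf.expectation ?M (\<lambda>x. - ln (pmf ?M x))"
    by (rule pmf_expectation_bind[symmetric]) (use fQ fK in auto)
  finally show ?thesis by (simp add: shannon_entropy_expectation)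
qed

section \<open>Laws and characteristic functions of the walks\<close>

lemma expectation_bind_pmf_real:
  fixes f :: "'b \<Rightarrow> real"
  assumes "\<And>x. \<bar>f x\<bar> \<le> 1"
  shows "measure_pmf.expectation (bind_pmf p K) f
    = measure_pmf.expectation p (\<lambda>x. measure_pmf.expectation (K x) f)"
  unfolding measure_pmf_bind using measurable_measure_pmf[of K]
  by (intro integral_bind[where K="count_space UNIV" and B=1 and B'=1])
    (use assms in \<open>auto simp: measure_pmf.emeasure_space_1 intro: measure_pmf.finite_measure\<close>)

lemma cmod_expectation_le_1:
  fixes f :: "'a \<Rightarrow> complex"
  assumes "\<And>x. cmod (f x) \<le> 1"
  shows "cmod (measure_pmf.expectation p f) \<le> 1"
proof -
  have "cmod (measure_pmf.expectation p f) \<le> measure_pmf.expectation p (\<lambda>x. cmod (f x))"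
    by (rule integral_norm_bound)
  also have "\<dots> \<le> measure_pmf.expectation p (\<lambda>x. 1)"
    using assms by (intro integral_mono measure_pmf.integrable_const_bound[where B=1]) auto
  finally show ?thesis by simp
qed

lemma expectation_bind_pmf:
  fixes f :: "'b \<Rightarrow> complex"
  assumes f: "\<And>x. cmod (f x) \<le> 1"
  shows "measure_pmf.expectation (bind_pmf p K) f
    = measure_pmf.expectation p (\<lambda>x. measure_pmf.expectation (K x) f)"
proof -
  have int: "integrable (measure_pmf q) f" for q
    by (rule measure_pmf.integrable_const_bound[where B=1]) (use f in auto)
  have int': "integrable (measure_pmf p) (\<lambda>x. measure_pmf.expectation (K x) f)"
    by (rule measure_pmf.integrable_const_bound[where B=1]) (auto intro: cmod_expectation_le_1 f)
  have "\<bar>Re (f x)\<bar> \<le> 1" "\<bar>Im (f x)\<bar> \<le> 1" for x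
    using f[of x] abs_Re_le_cmod[of "f x"] abs_Im_le_cmod[of "f x"] by linarith+
  then show ?thesis
    using expectation_bind_pmf_real[of "\<lambda>x. Re (f x)" p K]
      expectation_bind_pmf_real[of "\<lambda>x. Im (f x)" p K]
    by (simp add: complex_eq_iff int int' flip: integral_Re integral_Im)
qed

lemma pmf_jump_count:
  assumes "s \<ge> 0"
  shows "pmf (jump_count s) m = s ^ m / fact m * exp (- s)"
proof (cases "s = 0")
  case True
  then show ?thesis by (cases "m = 0") (auto simp: jump_count_def pmf_return)
qed (use assms in \<open>auto simp: jump_count_def\<close>)

lemma jump_count_0 [simp]: "jump_count 0 = return_pmf 0"
  by (simp add: jump_count_def)

text \<open>
  Sums of independent Poisson variables are Poisson variables; this makes the walk a convolution
  semigroup in time.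
\<close>

lemma jump_count_add:
  assumes s: "s \<ge> 0" and t: "t \<ge> 0"
  shows "bind_pmf (jump_count s) (\<lambda>a. map_pmf ((+) a) (jump_count t)) = jump_count (s + t)"
proof (rule pmf_eqI)
  fix m :: nat
  have shift: "pmf (map_pmf ((+) a) (jump_count t)) m = (if a \<le> m then pmf (jump_count t) (m - a) else 0)" for a
  proof (cases "a \<le> m")
    case True
    then show ?thesis using pmf_map_inj'[of "(+) a" "jump_count t" "m - a"] by simp
  next
    case False
    then have "m \<notin> set_pmf (map_pmf ((+) a) (jump_count t))" by auto
    with False show ?thesis by (simp only: pmf_eq_0_set_pmf[symmetric] if_False)
  qed
  have "pmf (bind_pmf (jump_count s) (\<lambda>a. map_pmf ((+) a) (jump_count t))) m
      = (\<Sum>a\<le>m. pmf (map_pmf ((+) a) (jump_count t)) m * pmf (jump_count s) a)"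
    unfolding pmf_bind by (rule integral_measure_pmf_real) (auto simp: shift split: if_splits)
  also have "\<dots> = (\<Sum>a\<le>m. exp (- (s + t)) / fact m * (of_nat (m choose a) * s ^ a * t ^ (m - a)))"
  proof (rule sum.cong[OF refl])
    fix a assume "a \<in> {..m}"
    then have "real (m choose a) = fact m / (fact a * fact (m - a))"
      by (simp add: binomial_fact)
    with \<open>a \<in> {..m}\<close> show "pmf (map_pmf ((+) a) (jump_count t)) m * pmf (jump_count s) a
        = exp (- (s + t)) / fact m * (of_nat (m choose a) * s ^ a * t ^ (m - a))"
      by (simp add: shift pmf_jump_count s t exp_add field_simps exp_diff exp_minus)
  qed
  also have "\<dots> = exp (- (s + t)) / fact m * (s + t) ^ m"
    by (simp add: binomial_ring sum_distrib_left)
  finally show "pmf (bind_pmf (jump_count s) (\<lambda>a. map_pmf ((+) a) (jump_count t))) m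
      = pmf (jump_count (s + t)) m"
    using s t by (simp add: pmf_jump_count)
qed

lemma reduce_infinity [simp]: "reduce \<infinity> x = x"
  by (simp add: reduce_def)

lemma reduce_enat [simp]: "reduce (enat L) x = x mod int L"
  by (simp add: reduce_def)

lemma jump_chain_reduce:
  "jump_chain w (enat L) m = map_pmf (\<lambda>x. x mod int L) (jump_chain w \<infinity> m)"
  by (induction m) (simp_all add: map_bind_pmf bind_map_pmf pmf.map_comp o_def mod_add_left_eq)

lemma walk_law_reduce:
  "walk_law w (enat L) s = map_pmf (\<lambda>x. x mod int L) (walk_law w \<infinity> s)"
  by (simp add: walk_law_def jump_chain_reduce[abs_def] map_bind_pmf)

lemma jump_chain_add:
  "jump_chain w \<infinity> (a + b) = bind_pmf (jump_chain w \<infinity> a) (\<lambda>x. map_pmf ((+) x) (jump_chain w \<infinity> b))"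
proof (induction b)
  case 0
  show ?case by (simp add: bind_return_pmf')
next
  case (Suc b)
  then show ?case
    by (simp add: bind_assoc_pmf map_bind_pmf bind_map_pmf pmf.map_comp o_def add.assoc[symmetric])
qed

lemma walk_law_add:
  assumes "s \<ge> 0" "t \<ge> 0"
  shows "walk_law w \<infinity> (s + t) = bind_pmf (walk_law w \<infinity> s) (\<lambda>x. map_pmf ((+) x) (walk_law w \<infinity> t))"
proof -
  let ?J = jump_count and ?C = "jump_chain w \<infinity>"
  have "walk_law w \<infinity> (s + t) = bind_pmf (?J s) (\<lambda>a. bind_pmf (?J t) (\<lambda>b.
      bind_pmf (?C a) (\<lambda>x. map_pmf ((+) x) (?C b))))"
    unfolding walk_law_def jump_count_add[OF assms, symmetric]
    by (simp add: bind_assoc_pmf bind_map_pmf jump_chain_add)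
  also have "\<dots> = bind_pmf (?J s) (\<lambda>a. bind_pmf (?C a) (\<lambda>x. bind_pmf (?J t) (\<lambda>b.
      map_pmf ((+) x) (?C b))))"
    by (subst bind_commute_pmf) simp
  also have "\<dots> = bind_pmf (walk_law w \<infinity> s) (\<lambda>x. map_pmf ((+) x) (walk_law w \<infinity> t))"
    by (simp add: walk_law_def bind_assoc_pmf map_bind_pmf)
  finally show ?thesis .
qed

lemma walk_law_0 [simp]: "walk_law w \<infinity> 0 = return_pmf 0"
  by (simp add: walk_law_def bind_return_pmf)

primrec jump_char :: "walk \<Rightarrow> real \<Rightarrow> complex"
  where
    "jump_char Simple \<theta> = complex_of_real (cos \<theta>)"
  | "jump_char Directed \<theta> = cis \<theta>"

lemma Re_jump_char [simp]: "Re (jump_char w \<theta>) = cos \<theta>"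
  by (cases w) auto

lemma norm_jump_char: "cmod (jump_char w \<theta>) \<le> 1"
  by (cases w) auto

lemma expectation_jump: "measure_pmf.expectation (jump_pmf w) (\<lambda>z. cis (\<theta> * of_int z)) = jump_char w \<theta>"
proof (cases w)
  case Simple
  have "measure_pmf.expectation (jump_pmf w) (\<lambda>z. cis (\<theta> * of_int z))
      = (\<Sum>z\<in>{-1,1}. (1/2) *\<^sub>R cis (\<theta> * of_int z))"
    unfolding Simple jump_pmf.simps by (subst integral_measure_pmf[of "{-1,1}"]) auto
  also have "\<dots> = jump_char w \<theta>"
    by (simp add: Simple complex_eq_iff)
  finally show ?thesis .
qed auto

lemma expectation_jump_chain:
  "measure_pmf.expectation (jump_chain w \<infinity> m) (\<lambda>z. cis (\<theta> * of_int z)) = jump_char w \<theta> ^ m"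
proof (induction m)
  case (Suc m)
  have "measure_pmf.expectation (jump_chain w \<infinity> (Suc m)) (\<lambda>z. cis (\<theta> * of_int z))
    = measure_pmf.expectation (jump_chain w \<infinity> m)
        (\<lambda>x. cis (\<theta> * of_int x) * measure_pmf.expectation (jump_pmf w) (\<lambda>z. cis (\<theta> * of_int z)))"
    by (simp add: expectation_bind_pmf algebra_simps flip: cis_mult)
  also have "\<dots> = jump_char w \<theta> ^ Suc m"
    by (simp add: Suc.IH expectation_jump)
  finally show ?case .
qed simp

text \<open>
  The characteristic function of the position at time \<open>s\<close>, see \<open>expectation_walk_law\<close>.
\<close>

definition walk_char :: "walk \<Rightarrow> real \<Rightarrow> real \<Rightarrow> complex"
  where "walk_char w \<theta> s = exp (of_real s * (jump_char w \<theta> - 1))"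

lemma norm_walk_char: "cmod (walk_char w \<theta> s) = exp (- s * (1 - cos \<theta>))"
  by (simp add: walk_char_def algebra_simps)

lemma walk_char_add: "walk_char w \<theta> (s + t) = walk_char w \<theta> s * walk_char w \<theta> t"
  by (simp add: walk_char_def algebra_simps flip: exp_add)

lemma expectation_jump_count:
  assumes "s \<ge> 0" "cmod z \<le> 1"
  shows "measure_pmf.expectation (jump_count s) (\<lambda>m. z ^ m) = exp (of_real s * (z - 1))"
proof -
  define g where "g m = (s ^ m / fact m * exp (- s)) *\<^sub>R z ^ m" for m
  have g: "g m = of_real (exp (- s)) * ((of_real s * z) ^ m /\<^sub>R fact m)" for m
    by (simp add: g_def scaleR_conv_of_real power_mult_distrib field_simps)
  have "(\<lambda>m. (of_real s * z) ^ m /\<^sub>R fact m) sums exp (of_real s * z)"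
    by (rule exp_converges)
  then have sums: "g sums (of_real (exp (- s)) * exp (of_real s * z))"
    unfolding g by (rule sums_mult)
  have "summable (\<lambda>m. norm (g m))"
    unfolding g norm_mult by (intro summable_mult summable_norm_exp)
  then have "integral\<^sup>L (count_space UNIV) g = suminf g"
    by (intro integral_count_space_nat) (simp add: integrable_count_space_nat_iff)
  also have "\<dots> = of_real (exp (- s)) * exp (of_real s * z)"
    using sums by (simp add: sums_iff)
  also have "\<dots> = exp (of_real s * (z - 1))"
    by (simp add: exp_of_real exp_diff exp_minus field_simps)
  also have "integral\<^sup>L (count_space UNIV) g = measure_pmf.expectation (jump_count s) (\<lambda>m. z ^ m)"
    unfolding measure_pmf_eq_density
    by (subst integral_density) (auto simp: g_def[abs_def] pmf_jump_count assms)
  finally show ?thesis .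
qed

lemma expectation_walk_law:
  assumes "s \<ge> 0"
  shows "measure_pmf.expectation (walk_law w \<infinity> s) (\<lambda>x. cis (\<theta> * of_int x)) = walk_char w \<theta> s"
  using assms unfolding walk_law_def
  by (simp add: expectation_bind_pmf expectation_jump_chain expectation_jump_count
      norm_jump_char walk_char_def)

section \<open>Entropy of the walk on a cycle\<close>

lemma shannon_entropy_map_inj:
  assumes "inj_on f (set_pmf p)"
  shows "shannon_entropy (map_pmf f p) = shannon_entropy p"
  unfolding shannon_entropy_expectation integral_map_pmf
  by (rule integral_cong_AE) (auto simp: AE_measure_pmf_iff pmf_map_inj[OF assms])

lemma cis_root_mod:
  assumes "L > 0"
  shows "cis (2 * pi * real j / real L * of_int (x mod int L)) = cis (2 * pi * real j / real L * of_int x)"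
proof -
  have "of_int x = of_int (x div int L) * real L + (of_int (x mod int L) :: real)"
    by (metis div_mult_mod_eq of_int_add of_int_mult of_int_of_nat_eq)
  then have "2 * pi * real j / real L * of_int x
      = 2 * pi * (real j * of_int (x div int L)) + 2 * pi * real j / real L * of_int (x mod int L)"
    using assms by (simp add: field_simps)
  moreover have "cis (2 * pi * (real j * of_int (x div int L))) = 1"
    by (intro cis_multiple_2pi) auto
  ultimately show ?thesis by (simp flip: cis_mult)
qed

lemma set_walk_law:
  assumes "L > 0"
  shows "set_pmf (walk_law w (enat L) s) \<subseteq> {0..<int L}"
  using assms by (auto simp: walk_law_reduce)

lemma finite_set_walk_law:
  "L > 0 \<Longrightarrow> finite (set_pmf (walk_law w (enat L) s))"
  using finite_subset[OF set_walk_law] by blast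

lemma walk_law_add_mod:
  assumes "s \<ge> 0" "t \<ge> 0"
  shows "walk_law w (enat L) (s + t)
    = bind_pmf (walk_law w (enat L) t) (\<lambda>y. map_pmf (\<lambda>x. (y + x) mod int L) (walk_law w (enat L) s))"
proof -
  have "walk_law w (enat L) (t + s) = bind_pmf (walk_law w \<infinity> t) (\<lambda>y. map_pmf (\<lambda>x. (y + x) mod int L) (walk_law w \<infinity> s))"
    unfolding walk_law_reduce walk_law_add[OF assms(2,1)]
    by (simp add: map_bind_pmf pmf.map_comp o_def)
  then show ?thesis
    by (simp add: walk_law_reduce bind_map_pmf pmf.map_comp o_def mod_add_eq add.commute)
qed

lemma expectation_walk_law_mod:
  assumes "L > 0" "s \<ge> 0"
  shows "measure_pmf.expectation (walk_law w (enat L) s) (\<lambda>x. cis (2 * pi * real j / real L * of_int x))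
    = walk_char w (2 * pi * real j / real L) s"
  unfolding walk_law_reduce integral_map_pmf cis_root_mod[OF assms(1)] expectation_walk_law[OF assms(2)] ..

lemma cis_variance:
  fixes Q :: "int pmf" and \<theta> :: real
  assumes "finite (set_pmf Q)"
  defines "\<phi> \<equiv> measure_pmf.expectation Q (\<lambda>y. cis (\<theta> * of_int y))"
  shows "measure_pmf.expectation Q (\<lambda>y. (cmod (cis (\<theta> * of_int y) - \<phi>))\<^sup>2) = 1 - (cmod \<phi>)\<^sup>2"
proof -
  have int [simp]: "integrable (measure_pmf Q) f" for f :: "int \<Rightarrow> complex"
    by (rule integrable_measure_pmf_finite[OF assms(1)])
  have intr [simp]: "integrable (measure_pmf Q) f" for f :: "int \<Rightarrow> real"
    by (rule integrable_measure_pmf_finite[OF assms(1)])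
  have "(cmod (cis a - \<phi>))\<^sup>2 = 1 + (cmod \<phi>)\<^sup>2 - 2 * Re (cnj \<phi> * cis a)" for a
  proof -
    have "(cos a)\<^sup>2 + (sin a)\<^sup>2 = 1" by simp
    then show ?thesis by (simp add: cmod_power2 power2_diff algebra_simps)
  qed
  then have "measure_pmf.expectation Q (\<lambda>y. (cmod (cis (\<theta> * of_int y) - \<phi>))\<^sup>2)
      = 1 + (cmod \<phi>)\<^sup>2 - 2 * measure_pmf.expectation Q (\<lambda>y. Re (cnj \<phi> * cis (\<theta> * of_int y)))"
    by (simp del: times_complex.sel)
  also have "measure_pmf.expectation Q (\<lambda>y. Re (cnj \<phi> * cis (\<theta> * of_int y))) = Re (cnj \<phi> * \<phi>)"
    by (simp add: \<phi>_def del: times_complex.sel)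
  also have "\<dots> = (cmod \<phi>)\<^sup>2"
    unfolding cmod_power2 by (simp add: power2_eq_square)
  finally show ?thesis by simp
qed

text \<open>
  Mixing over the displacement \<open>y\<close> during the last \<open>t\<close> time units, a character of the cycle has mean
  \<open>cis (\<theta> y) \<phi> s\<close> under the translated component and \<open>\<phi> t \<phi> s\<close> under the mixture. The average squared
  difference is the variance of \<open>cis (\<theta> y)\<close> times the squared modulus of \<open>\<phi> s\<close>, whence the explicit
  increment. Its independence of \<open>L\<close> other than through the angle makes it survive the limit
  \<open>L \<rightarrow> \<infinity>\<close>.
\<close>

lemma walk_entropy_increment:
  fixes L j :: nat
  assumes L: "L > 0" and s: "s \<ge> 0" and t: "t \<ge> 0"
  defines "u \<equiv> 1 - cos (2 * pi * real j / real L)"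
  shows "walk_entropy w (enat L) s + exp (- 2 * s * u) * (1 - exp (- 2 * t * u)) / 4
    \<le> walk_entropy w (enat L) (s + t)"
proof -
  define \<theta> where "\<theta> = 2 * pi * real j / real L"
  define f where "f x = cis (\<theta> * of_int x)" for x :: int
  define Q where "Q = walk_law w (enat L) t"
  define P where "P = walk_law w (enat L) s"
  define K where "K y = map_pmf (\<lambda>x. (y + x) mod int L) P" for y
  define \<phi> where "\<phi> = walk_char w \<theta>"
  have fin: "finite (set_pmf Q)" "finite (set_pmf P)"
    unfolding P_def Q_def by (intro finite_set_walk_law L)+
  have M: "walk_law w (enat L) (s + t) = bind_pmf Q K"
    unfolding Q_def K_def[abs_def] P_def by (rule walk_law_add_mod[OF s t])
  have K_ent: "shannon_entropy (K y) = walk_entropy w (enat L) s" for y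
  proof -
    have "inj_on (\<lambda>x. (y + x) mod int L) {0..<int L}"
    proof (rule inj_onI)
      fix a b assume a: "a \<in> {0..<int L}" and b: "b \<in> {0..<int L}" and "(y + a) mod int L = (y + b) mod int L"
      then have "int L dvd a - b"
        by (simp add: mod_eq_dvd_iff)
      then have "a mod int L = b mod int L"
        by (simp only: mod_eq_dvd_iff)
      moreover have "a mod int L = a" "b mod int L = b" using a b by auto
      ultimately show "a = b" by metis
    qed
    then have "inj_on (\<lambda>x. (y + x) mod int L) (set_pmf P)"
      unfolding P_def by (rule inj_on_subset[OF _ set_walk_law[OF L]])
    then show ?thesis
      unfolding K_def walk_entropy_def P_def[symmetric] by (rule shannon_entropy_map_inj)
  qed
  have f_mod: "f (x mod int L) = f x" for x
    unfolding f_def \<theta>_def by (rule cis_root_mod[OF L])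
  have K_char: "measure_pmf.expectation (K y) f = f y * \<phi> s" for y
  proof -
    have "f ((y + x) mod int L) = f y * f x" for x
      unfolding f_mod by (simp add: f_def algebra_simps cis_mult)
    then have "measure_pmf.expectation (K y) f = f y * measure_pmf.expectation P f"
      by (simp add: K_def)
    then show ?thesis
      using expectation_walk_law_mod[OF L s, of w j] unfolding P_def f_def \<theta>_def \<phi>_def by simp
  qed
  have M_char: "measure_pmf.expectation (bind_pmf Q K) f = \<phi> t * \<phi> s"
    using expectation_walk_law_mod[OF L, of "s + t" w j] s t
    unfolding M[symmetric] f_def \<theta>_def[symmetric] \<phi>_def by (simp add: walk_char_add)
  have Q_char: "measure_pmf.expectation Q f = \<phi> t"
    using expectation_walk_law_mod[OF L t, of w j] unfolding Q_def f_def \<theta>_def \<phi>_def by simp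
  have "walk_entropy w (enat L) s + (cmod (\<phi> s))\<^sup>2 * (1 - (cmod (\<phi> t))\<^sup>2) / 4
      = measure_pmf.expectation Q (\<lambda>y. walk_entropy w (enat L) s + (cmod (\<phi> s))\<^sup>2 * (cmod (f y - \<phi> t))\<^sup>2 / 4)"
    using cis_variance[OF fin(1), of \<theta>] fin(1)
    unfolding f_def[symmetric] Q_char by (simp add: integrable_measure_pmf_finite)
  also have "\<dots> = measure_pmf.expectation Q (\<lambda>y. shannon_entropy (K y)
      + (cmod (measure_pmf.expectation (K y) f - measure_pmf.expectation (bind_pmf Q K) f))\<^sup>2 / 4)"
  proof -
    have "(cmod (f y * \<phi> s - \<phi> t * \<phi> s))\<^sup>2 = (cmod (\<phi> s))\<^sup>2 * (cmod (f y - \<phi> t))\<^sup>2" for y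
      by (simp add: norm_mult power_mult_distrib flip: left_diff_distrib)
    then show ?thesis by (simp add: K_ent K_char M_char)
  qed
  also have "\<dots> \<le> shannon_entropy (bind_pmf Q K)"
    by (rule entropy_mixture_ge) (use fin in \<open>auto simp: K_def f_def\<close>)
  also have "\<dots> = walk_entropy w (enat L) (s + t)"
    unfolding walk_entropy_def M ..
  finally have "walk_entropy w (enat L) s + (cmod (\<phi> s))\<^sup>2 * (1 - (cmod (\<phi> t))\<^sup>2) / 4
      \<le> walk_entropy w (enat L) (s + t)" .
  moreover have "(cmod (\<phi> r))\<^sup>2 = exp (- 2 * r * u)" for r
    by (simp add: \<phi>_def norm_walk_char u_def \<theta>_def mult.assoc flip: exp_double)
  ultimately show ?thesis by simp
qed

lemma sum_cis_roots:
  assumes L: "L > 0" and k: "\<bar>k\<bar> < int L"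
  shows "(\<Sum>j<L. cis (2 * pi * real j / real L * of_int k)) = (if k = 0 then of_nat L else 0)"
proof (cases "k = 0")
  case False
  define \<omega> where "\<omega> = cis (2 * pi * of_int k / real L)"
  have "\<omega> \<noteq> 1"
  proof
    assume "\<omega> = 1"
    then have "cos (2 * pi * of_int k / real L) = 1"
      by (simp add: \<omega>_def complex_eq_iff)
    then obtain n :: int where "2 * pi * of_int k / real L = of_int n * 2 * pi"
      by (auto simp: cos_one_2pi_int)
    then have "of_int k = (of_int n * real L :: real)"
      using L by (simp add: field_simps)
    then have "k = n * int L"
      by (metis of_int_eq_iff of_int_mult of_int_of_nat_eq)
    with k False show False
      by (metis abs_mult abs_of_nat dvd_triv_right zdvd_not_zless abs_dvd_iff dvd_abs_iff zero_less_abs_iff)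
  qed
  have "(\<Sum>j<L. cis (2 * pi * real j / real L * of_int k)) = (\<Sum>j<L. \<omega> ^ j)"
  proof (rule sum.cong[OF refl])
    fix j
    have "2 * pi * real j / real L * of_int k = real j * (2 * pi * of_int k / real L)"
      by simp
    then show "cis (2 * pi * real j / real L * of_int k) = \<omega> ^ j"
      by (simp only: \<omega>_def Complex.DeMoivre)
  qed
  also have "\<dots> = (\<omega> ^ L - 1) / (\<omega> - 1)"
    by (rule geometric_sum[OF \<open>\<omega> \<noteq> 1\<close>])
  also have "\<omega> ^ L = cis (2 * pi * of_int k)"
    using L by (simp add: \<omega>_def Complex.DeMoivre)
  also have "\<dots> = 1" by (intro cis_multiple_2pi) auto
  finally show ?thesis using False by simp
qed auto

text \<open>
  Fourier inversion on the cycle. It gives continuity in time, and a bound on the largest point mass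
  which in turn bounds the entropy from below.
\<close>

lemma pmf_walk_law_fourier:
  assumes L: "L > 0" and s: "s \<ge> 0" and r: "r \<in> {0..<int L}"
  shows "pmf (walk_law w (enat L) s) r
    = Re (\<Sum>j<L. walk_char w (2 * pi * real j / real L) s * cis (- (2 * pi * real j / real L * of_int r))) / real L"
proof -
  let ?P = "walk_law w (enat L) s"
  let ?e = "\<lambda>j x. cis (2 * pi * real j / real L * of_int x)"
  have fin: "finite (set_pmf ?P)"
    by (rule finite_set_walk_law[OF L])
  have int: "integrable (measure_pmf ?P) g" for g :: "int \<Rightarrow> complex"
    by (rule integrable_measure_pmf_finite[OF fin])
  have "(\<Sum>j<L. walk_char w (2 * pi * real j / real L) s * cis (- (2 * pi * real j / real L * of_int r)))
      = (\<Sum>j<L. measure_pmf.expectation ?P (?e j) * cis (- (2 * pi * real j / real L * of_int r)))"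
    using expectation_walk_law_mod[OF L s] by simp
  also have "\<dots> = measure_pmf.expectation ?P (\<lambda>x. \<Sum>j<L. ?e j (x - r))"
  proof -
    have "?e j (x - r) = ?e j x * cis (- (2 * pi * real j / real L * of_int r))" for j x
      by (simp add: cis_mult right_diff_distrib diff_divide_distrib)
    then show ?thesis by (simp add: int)
  qed
  also have "\<dots> = (\<Sum>x\<in>{0..<int L}. pmf ?P x *\<^sub>R (\<Sum>j<L. ?e j (x - r)))"
    by (rule integral_measure_pmf) (use set_walk_law[OF L, of w s] in auto)
  also have "\<dots> = (\<Sum>x\<in>{0..<int L}. if x = r then of_real (pmf ?P r * real L) else 0)"
  proof (rule sum.cong[OF refl])
    fix x assume "x \<in> {0..<int L}"
    with r have "\<bar>x - r\<bar> < int L" by auto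
    from sum_cis_roots[OF L this]
    show "pmf ?P x *\<^sub>R (\<Sum>j<L. ?e j (x - r)) = (if x = r then of_real (pmf ?P r * real L) else 0)"
      by (simp add: scaleR_conv_of_real)
  qed
  also have "\<dots> = of_real (pmf ?P r * real L)"
    using r by simp
  finally show ?thesis using L by simp
qed

lemma pmf_walk_law_le:
  assumes L: "L > 0" and s: "s \<ge> 0"
  shows "pmf (walk_law w (enat L) s) r \<le> (\<Sum>j<L. exp (- s * (1 - cos (2 * pi * real j / real L)))) / real L"
proof (cases "r \<in> {0..<int L}")
  case True
  have "Re (\<Sum>j<L. walk_char w (2 * pi * real j / real L) s * cis (- (2 * pi * real j / real L * of_int r)))
      \<le> cmod (\<Sum>j<L. walk_char w (2 * pi * real j / real L) s * cis (- (2 * pi * real j / real L * of_int r)))"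
    by (rule complex_Re_le_cmod)
  also have "\<dots> \<le> (\<Sum>j<L. exp (- s * (1 - cos (2 * pi * real j / real L))))"
    by (rule sum_norm_le) (simp add: norm_mult norm_walk_char)
  finally show ?thesis
    using L by (simp add: pmf_walk_law_fourier[OF L s True] divide_right_mono)
next
  case False
  then have "pmf (walk_law w (enat L) s) r = 0"
    using set_walk_law[OF L, of w s] by (auto simp: set_pmf_iff)
  then show ?thesis by (simp add: sum_nonneg)
qed

lemma walk_entropy_ge_fourier:
  assumes L: "L > 0" and s: "s \<ge> 0"
  shows "ln (real L) - ln (\<Sum>j<L. exp (- s * (1 - cos (2 * pi * real j / real L)))) \<le> walk_entropy w (enat L) s"
proof -
  let ?P = "walk_law w (enat L) s"
  let ?S = "\<Sum>j<L. exp (- s * (1 - cos (2 * pi * real j / real L)))"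
  have S: "?S > 0" using L by (intro sum_pos) auto
  have fin: "finite (set_pmf ?P)"
    by (rule finite_set_walk_law[OF L])
  have "ln (real L) - ln ?S = measure_pmf.expectation ?P (\<lambda>x. ln (real L) - ln ?S)"
    by simp
  also have "\<dots> \<le> measure_pmf.expectation ?P (\<lambda>x. - ln (pmf ?P x))"
  proof (rule integral_mono_AE)
    show "AE x in measure_pmf ?P. ln (real L) - ln ?S \<le> - ln (pmf ?P x)"
    proof (rule AE_pmfI)
      fix x assume "x \<in> set_pmf ?P"
      then have "ln (pmf ?P x) \<le> ln (?S / real L)"
        using pmf_walk_law_le[OF L s, of w x] by (intro ln_mono) (auto simp: pmf_positive)
      then show "ln (real L) - ln ?S \<le> - ln (pmf ?P x)"
        using S L by (simp add: ln_div)
    qed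
  qed (intro integrable_measure_pmf_finite fin)+
  finally show ?thesis by (simp add: walk_entropy_def shannon_entropy_expectation)
qed

lemma continuous_on_x_ln_x: "continuous_on {0..} (\<lambda>x::real. x * ln x)"
proof (unfold continuous_on_def, intro ballI)
  fix x :: real assume "x \<in> {0..}"
  show "((\<lambda>x. x * ln x) \<longlongrightarrow> x * ln x) (at x within {0..})"
  proof (cases "x = 0")
    case True
    have "((\<lambda>x::real. x * ln x) \<longlongrightarrow> 0) (at_right 0)" by real_asymp
    moreover have "at (0::real) within {0..} = at_right 0"
    proof -
      have "{0..} - {0} = {0<..} - {0::real}" by auto
      then show ?thesis by (simp add: at_within_def)
    qed
    ultimately show ?thesis using True by simp
  next
    case False
    with \<open>x \<in> {0..}\<close> show ?thesis by (auto intro!: tendsto_intros)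
  qed
qed

lemma continuous_on_walk_entropy:
  assumes L: "L > 0"
  shows "continuous_on {0..} (walk_entropy w (enat L))"
proof -
  have p: "continuous_on {0..} (\<lambda>s. pmf (walk_law w (enat L) s) r)" if r: "r \<in> {0..<int L}" for r
  proof -
    have "continuous_on {0..} (\<lambda>s. Re (\<Sum>j<L. walk_char w (2 * pi * real j / real L) s
        * cis (- (2 * pi * real j / real L * of_int r))) / real L)"
      unfolding walk_char_def using L by (intro continuous_intros) auto
    then show ?thesis
      by (rule continuous_on_eq) (simp add: pmf_walk_law_fourier[OF L _ r])
  qed
  have "continuous_on {0..} (\<lambda>s. \<Sum>r\<in>{0..<int L}. - (pmf (walk_law w (enat L) s) r * ln (pmf (walk_law w (enat L) s) r)))"
    by (intro continuous_on_sum continuous_on_minus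
        continuous_on_compose2[OF continuous_on_x_ln_x p]) (auto simp: pmf_nonneg)
  then show ?thesis
    unfolding walk_entropy_def[abs_def]
    by (rule continuous_on_eq) (intro shannon_entropy_sum[symmetric] set_walk_law L, simp)
qed

section \<open>Entropy under a map, and second moments\<close>

lemma pmf_le_pmf_map: "pmf p x \<le> pmf (map_pmf f p) (f x)"
proof -
  have "measure (measure_pmf p) {x} \<le> measure (measure_pmf p) (f -` {f x})"
    by (rule measure_pmf.finite_measure_mono) auto
  then show ?thesis by (simp add: pmf_map measure_pmf_single)
qed

lemma entropy_map_le:
  fixes p :: "int pmf" and f :: "int \<Rightarrow> int"
  assumes fin: "finite (set_pmf (map_pmf f p))" and int: "integrable (measure_pmf p) (\<lambda>x. - ln (pmf p x))"
  shows "shannon_entropy (map_pmf f p) \<le> shannon_entropy p"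
proof -
  have int': "integrable (measure_pmf (map_pmf f p)) (\<lambda>y. - ln (pmf (map_pmf f p) y))"
    by (rule integrable_measure_pmf_finite[OF fin])
  have "measure_pmf.expectation p (\<lambda>x. - ln (pmf (map_pmf f p) (f x))) \<le> measure_pmf.expectation p (\<lambda>x. - ln (pmf p x))"
  proof (rule integral_mono_AE[OF _ int])
    show "integrable (measure_pmf p) (\<lambda>x. - ln (pmf (map_pmf f p) (f x)))"
      using int' by simp
    show "AE x in measure_pmf p. - ln (pmf (map_pmf f p) (f x)) \<le> - ln (pmf p x)"
      by (rule AE_pmfI) (use pmf_le_pmf_map[of p _ f] in \<open>auto simp: pmf_positive intro!: ln_mono\<close>)
  qed
  then show ?thesis by (simp add: shannon_entropy_expectation)
qed

text \<open>
  A reference law on the integers that puts mass at least \<open>1 - \<rho>\<close> on 0 and only geometrically small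
  mass, scaled by \<open>\<rho>\<close>, elsewhere. It is encoded as a mixture of the point mass at 0 with a geometric
  law transported to the integers, since only lower bounds for its masses are needed.
\<close>

definition block_pmf :: "real \<Rightarrow> int pmf"
  where "block_pmf \<rho> = map_pmf (\<lambda>(z, n). if z then 0 else int_decode n)
    (pair_pmf (bernoulli_pmf (1 - \<rho>)) (geometric_pmf (1 / 2)))"

lemma block_pmf_bound:
  assumes \<rho>: "0 < \<rho>" "\<rho> < 1"
  shows "pmf (block_pmf \<rho>) b > 0"
    and "- ln (pmf (block_pmf \<rho>) b) \<le> - ln (1 - \<rho>) + \<bar>of_int b\<bar> * ln (8 / \<rho>)"
proof -
  let ?r = "pair_pmf (bernoulli_pmf (1 - \<rho>)) (geometric_pmf (1 / 2))"
  let ?h = "\<lambda>(z, n). if z then 0 else int_decode n"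
  have "0 < pmf (block_pmf \<rho>) b \<and> - ln (pmf (block_pmf \<rho>) b) \<le> - ln (1 - \<rho>) + \<bar>of_int b\<bar> * ln (8 / \<rho>)"
  proof (cases "b = 0")
    case True
    have "1 - \<rho> = pmf (map_pmf fst ?r) True"
      using \<rho> by (simp add: map_fst_pair_pmf)
    also have "\<dots> = measure (measure_pmf ?r) (fst -` {True})"
      by (simp add: pmf_map)
    also have "\<dots> \<le> measure (measure_pmf ?r) (?h -` {0})"
      by (rule measure_pmf.finite_measure_mono) auto
    also have "\<dots> = pmf (block_pmf \<rho>) b"
      by (simp add: block_pmf_def pmf_map True)
    finally have "1 - \<rho> \<le> pmf (block_pmf \<rho>) b" .
    moreover from this have "ln (1 - \<rho>) \<le> ln (pmf (block_pmf \<rho>) b)"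
      using \<rho> by (intro ln_mono) auto
    ultimately show ?thesis using \<rho> True by auto
  next
    case False
    have enc: "real (int_encode b) \<le> 2 * \<bar>of_int b\<bar>"
      by (auto simp: int_encode_def sum_encode_def)
    have "\<rho> * (1 / 2) ^ Suc (int_encode b) = pmf ?r (False, int_encode b)"
      using \<rho> by (simp add: pmf_pair)
    also have "\<dots> \<le> pmf (block_pmf \<rho>) (?h (False, int_encode b))"
      unfolding block_pmf_def by (rule pmf_le_pmf_map)
    also have "?h (False, int_encode b) = b" by simp
    finally have le: "\<rho> * (1 / 2) ^ Suc (int_encode b) \<le> pmf (block_pmf \<rho>) b" .
    have pos: "0 < \<rho> * (1 / 2) ^ Suc (int_encode b)" using \<rho> by simp
    have "- ln (pmf (block_pmf \<rho>) b) \<le> - ln (\<rho> * (1 / 2) ^ Suc (int_encode b))"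
      using le pos by (simp del: power_Suc)
    also have "\<dots> = - ln \<rho> + real (Suc (int_encode b)) * ln 2"
      using \<rho> by (simp add: ln_mult ln_realpow ln_div del: power_Suc)
    also have "\<dots> \<le> \<bar>of_int b\<bar> * (- ln \<rho>) + (\<bar>of_int b\<bar> * 3) * ln 2"
    proof (intro add_mono mult_right_mono)
      have "1 \<le> \<bar>of_int b :: real\<bar>" using False by linarith
      then show "real (Suc (int_encode b)) \<le> \<bar>of_int b\<bar> * 3" using enc by simp
      show "- ln \<rho> \<le> \<bar>of_int b\<bar> * (- ln \<rho>)"
        using \<open>1 \<le> \<bar>of_int b :: real\<bar>\<close> \<rho> mult_right_mono[of 1 "\<bar>of_int b :: real\<bar>" "- ln \<rho>"] by simp
    qed auto
    also have "\<dots> = \<bar>of_int b\<bar> * ln (8 / \<rho>)"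
    proof -
      have "ln (8 :: real) = ln (2 ^ 3)" by simp
      also have "\<dots> = 3 * ln 2" by (subst ln_realpow) auto
      finally show ?thesis using \<rho> by (simp add: ln_div algebra_simps)
    qed
    also have "\<dots> \<le> - ln (1 - \<rho>) + \<dots>" using \<rho> by simp
    finally show ?thesis using le pos by linarith
  qed
  then show "pmf (block_pmf \<rho>) b > 0"
    and "- ln (pmf (block_pmf \<rho>) b) \<le> - ln (1 - \<rho>) + \<bar>of_int b\<bar> * ln (8 / \<rho>)" by auto
qed

text \<open>
  The converse of \<open>entropy_map_le\<close>: if \<open>B x\<close> is the missing information that recovers \<open>x\<close> from
  \<open>f x\<close>, then the entropy lost by \<open>f\<close> is at most that of \<open>B\<close>. Gibbs' inequality against the product of
  the law of \<open>f\<close> with the reference law makes this small as soon as \<open>B\<close> is rarely nonzero, and also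
  shows that the entropy of \<open>p\<close> is a convergent series.
\<close>

lemma entropy_le_entropy_map:
  fixes p :: "int pmf" and f B :: "int \<Rightarrow> int" and \<rho> v :: real
  assumes fin: "finite (set_pmf (map_pmf f p))" and inj: "inj (\<lambda>x. (f x, B x))"
    and \<rho>: "0 < \<rho>" "\<rho> < 1"
    and int: "integrable (measure_pmf p) (\<lambda>x. \<bar>of_int (B x)\<bar> :: real)"
    and v: "measure_pmf.expectation p (\<lambda>x. \<bar>of_int (B x)\<bar>) \<le> v"
  shows "integrable (measure_pmf p) (\<lambda>x. - ln (pmf p x))"
    and "shannon_entropy p \<le> shannon_entropy (map_pmf f p) - ln (1 - \<rho>) + v * ln (8 / \<rho>)"
proof -
  let ?F = "map_pmf f p" and ?R = "pair_pmf (map_pmf f p) (block_pmf \<rho>)"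
  define m where "m x = pmf ?R (f x, B x)" for x
  define G where "G x = - ln (pmf ?F (f x)) + (- ln (1 - \<rho>) + \<bar>of_int (B x)\<bar> * ln (8 / \<rho>)) + (m x / pmf p x - 1)" for x
  have "integrable (measure_pmf ?F) (\<lambda>y. - ln (pmf ?F y))"
    by (rule integrable_measure_pmf_finite[OF fin])
  then have i1: "integrable (measure_pmf p) (\<lambda>x. - ln (pmf ?F (f x)))" by simp
  have nn: "(\<integral>\<^sup>+x. ennreal (m x / pmf p x) \<partial>measure_pmf p) \<le> ennreal 1"
  proof -
    have "(\<integral>\<^sup>+x. ennreal (m x / pmf p x) \<partial>measure_pmf p) = (\<integral>\<^sup>+x. ennreal (pmf p x) * ennreal (m x / pmf p x) \<partial>count_space UNIV)"
      by (rule nn_integral_measure_pmf)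
    also have "\<dots> \<le> (\<integral>\<^sup>+x. ennreal (pmf ?R (f x, B x)) \<partial>count_space UNIV)"
    proof (rule nn_integral_mono)
      fix x
      show "ennreal (pmf p x) * ennreal (m x / pmf p x) \<le> ennreal (pmf ?R (f x, B x))"
        by (cases "pmf p x = 0") (auto simp: m_def pmf_nonneg simp flip: ennreal_mult)
    qed
    also have "\<dots> = emeasure (measure_pmf ?R) (range (\<lambda>x. (f x, B x)))"
      by (rule nn_integral_pmf'[OF inj])
    also have "\<dots> \<le> ennreal 1"
      by (simp add: measure_pmf.emeasure_eq_measure del: ennreal_1)
    finally show ?thesis .
  qed
  have i2: "integrable (measure_pmf p) (\<lambda>x. m x / pmf p x)"
    by (rule integrableI_bounded) (use nn in \<open>auto simp: m_def pmf_nonneg less_top[symmetric] top_unique\<close>)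
  have e2: "measure_pmf.expectation p (\<lambda>x. m x / pmf p x) \<le> 1"
    by (rule integral_real_bounded[OF _ nn]) simp
  have iG: "integrable (measure_pmf p) G"
    unfolding G_def using i1 i2 int by auto
  have le: "AE x in measure_pmf p. - ln (pmf p x) \<le> G x"
  proof (rule AE_pmfI)
    fix x assume x: "x \<in> set_pmf p"
    then have p: "pmf p x > 0" and F: "pmf ?F (f x) > 0" by (auto simp: pmf_positive)
    note b = block_pmf_bound[OF \<rho>, of "B x"]
    have m: "m x = pmf ?F (f x) * pmf (block_pmf \<rho>) (B x)" by (simp add: m_def pmf_pair)
    then have "m x > 0" using F b by simp
    then have "ln (m x / pmf p x) \<le> m x / pmf p x - 1"
      using p by (intro ln_le_minus_one) auto
    moreover have "ln (m x / pmf p x) = ln (pmf ?F (f x)) + ln (pmf (block_pmf \<rho>) (B x)) - ln (pmf p x)"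
      using p F b unfolding m by (simp add: ln_div ln_mult)
    ultimately show "- ln (pmf p x) \<le> G x" using b unfolding G_def by linarith
  qed
  show i: "integrable (measure_pmf p) (\<lambda>x. - ln (pmf p x))"
  proof (rule Bochner_Integration.integrable_bound[OF iG])
    show "AE x in measure_pmf p. norm (- ln (pmf p x)) \<le> norm (G x)"
      using le
    proof eventually_elim
      case (elim x)
      have "ln (pmf p x) \<le> 0"
        using pmf_le_1[of p x] pmf_nonneg[of p x] by (cases "pmf p x = 0") auto
      with elim show ?case by simp
    qed
  qed simp
  have "shannon_entropy p \<le> measure_pmf.expectation p G"
    unfolding shannon_entropy_expectation by (rule integral_mono_AE[OF i iG le])
  also have "\<dots> = shannon_entropy ?F - ln (1 - \<rho>) + measure_pmf.expectation p (\<lambda>x. \<bar>of_int (B x)\<bar>) * ln (8 / \<rho>)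
      + (measure_pmf.expectation p (\<lambda>x. m x / pmf p x) - 1)"
    unfolding G_def using i1 i2 int by (simp add: shannon_entropy_expectation)
  also have "\<dots> \<le> shannon_entropy ?F - ln (1 - \<rho>) + v * ln (8 / \<rho>) + 0"
    using e2 v \<rho> by (intro add_mono mult_right_mono) auto
  finally show "shannon_entropy p \<le> shannon_entropy ?F - ln (1 - \<rho>) + v * ln (8 / \<rho>)" by simp
qed

lemma nn_integral_jump_count:
  assumes s: "s \<ge> 0" and g: "\<And>m. g m \<ge> 0"
    and sums: "(\<lambda>m. s ^ m / fact m * exp (- s) * g m) sums S"
  shows "(\<integral>\<^sup>+m. ennreal (g m) \<partial>measure_pmf (jump_count s)) = ennreal S"
proof -
  have "(\<integral>\<^sup>+m. ennreal (g m) \<partial>measure_pmf (jump_count s))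
      = (\<integral>\<^sup>+m. ennreal (s ^ m / fact m * exp (- s) * g m) \<partial>count_space UNIV)"
    unfolding nn_integral_measure_pmf using s
    by (intro nn_integral_cong) (simp add: pmf_jump_count g flip: ennreal_mult)
  also have "\<dots> = suminf (\<lambda>m. ennreal (s ^ m / fact m * exp (- s) * g m))"
    by (rule nn_integral_count_space_nat)
  also have "\<dots> = ennreal S"
    using s g sums by (intro suminf_ennreal_eq) auto
  finally show ?thesis .
qed

lemma poisson_sums:
  fixes s :: real
  shows "(\<lambda>m. s ^ m / fact m * exp (- s)) sums 1"
    and "(\<lambda>m. s ^ m / fact m * exp (- s) * real m) sums s"
    and "(\<lambda>m. s ^ m / fact m * exp (- s) * (real m)\<^sup>2) sums (s + s\<^sup>2)"
proof -
  have "(\<lambda>m. s ^ m /\<^sub>R fact m) sums exp s" by (rule exp_converges)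
  then have "(\<lambda>m. s ^ m /\<^sub>R fact m * exp (- s)) sums (exp s * exp (- s))" by (rule sums_mult2)
  then show 0: "(\<lambda>m. s ^ m / fact m * exp (- s)) sums 1"
    by (simp add: field_simps exp_minus)
  have shift: "s ^ Suc m / fact (Suc m) * exp (- s) * real (Suc m) = s * (s ^ m / fact m * exp (- s))" for m
    by (simp add: field_simps del: of_nat_Suc)
  have "(\<lambda>m. s ^ Suc m / fact (Suc m) * exp (- s) * real (Suc m)) sums (s * 1)"
    unfolding shift by (rule sums_mult[OF 0])
  then show 1: "(\<lambda>m. s ^ m / fact m * exp (- s) * real m) sums s"
    by (subst (asm) sums_Suc_iff) simp
  have shift2: "s ^ Suc m / fact (Suc m) * exp (- s) * (real (Suc m))\<^sup>2
      = s * (s ^ m / fact m * exp (- s) * real m + s ^ m / fact m * exp (- s))" for m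
    unfolding power2_eq_square mult.assoc[symmetric] shift by (simp add: algebra_simps add_divide_distrib)
  have "(\<lambda>m. s ^ Suc m / fact (Suc m) * exp (- s) * (real (Suc m))\<^sup>2) sums (s * (s + 1))"
    unfolding shift2 by (intro sums_mult sums_add 1 0)
  then show "(\<lambda>m. s ^ m / fact m * exp (- s) * (real m)\<^sup>2) sums (s + s\<^sup>2)"
    by (subst (asm) sums_Suc_iff) (simp add: power2_eq_square algebra_simps)
qed

lemma jump_chain_Directed: "jump_chain Directed \<infinity> m = return_pmf (int m)"
  by (induction m) (simp_all add: bind_return_pmf add.commute)

lemma nn_integral_jump_chain_Simple_square:
  "(\<integral>\<^sup>+x. ennreal ((of_int x - a)\<^sup>2) \<partial>measure_pmf (jump_chain Simple \<infinity> m)) = ennreal (real m + a\<^sup>2)"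
proof (induction m)
  case (Suc m)
  have step: "(\<integral>\<^sup>+z. ennreal ((of_int (x + z) - a)\<^sup>2) \<partial>measure_pmf (pmf_of_set {- 1, 1 :: int}))
      = ennreal ((of_int x - a)\<^sup>2) + ennreal 1" for x :: int
  proof -
    have "(\<integral>\<^sup>+z. ennreal ((of_int (x + z) - a)\<^sup>2) \<partial>measure_pmf (pmf_of_set {- 1, 1 :: int}))
        = ennreal (((of_int x - 1 - a)\<^sup>2 + (of_int x + 1 - a)\<^sup>2) / 2)"
    proof -
      have "(\<integral>\<^sup>+z. ennreal ((of_int (x + z) - a)\<^sup>2) \<partial>measure_pmf (pmf_of_set {- 1, 1 :: int}))
          = ennreal (measure_pmf.expectation (pmf_of_set {- 1, 1 :: int}) (\<lambda>z. (of_int (x + z) - a)\<^sup>2))"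
        by (rule nn_integral_eq_integral) (simp_all add: integrable_measure_pmf_finite)
      also have "measure_pmf.expectation (pmf_of_set {- 1, 1 :: int}) (\<lambda>z. (of_int (x + z) - a)\<^sup>2)
          = ((of_int x - 1 - a)\<^sup>2 + (of_int x + 1 - a)\<^sup>2) / 2"
        by (subst integral_measure_pmf[of "{- 1, 1}"]) auto
      finally show ?thesis .
    qed
    also have "((of_int x - 1 - a)\<^sup>2 + (of_int x + 1 - a)\<^sup>2) / 2 = (of_int x - a)\<^sup>2 + 1"
      by (simp add: power2_eq_square field_simps)
    finally show ?thesis by (simp add: ennreal_plus)
  qed
  have "(\<integral>\<^sup>+x. ennreal ((of_int x - a)\<^sup>2) \<partial>measure_pmf (jump_chain Simple \<infinity> (Suc m)))
      = (\<integral>\<^sup>+x. ennreal ((of_int x - a)\<^sup>2) + ennreal 1 \<partial>measure_pmf (jump_chain Simple \<infinity> m))"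
    by (simp only: jump_chain.simps jump_pmf.simps nn_integral_bind_pmf nn_integral_map_pmf step reduce_infinity)
  also have "\<dots> = ennreal (real m + a\<^sup>2) + ennreal 1"
    by (subst nn_integral_add) (simp_all add: Suc.IH measure_pmf.emeasure_space_1)
  also have "\<dots> = ennreal (real (Suc m) + a\<^sup>2)"
    by (subst ennreal_plus[symmetric]) (simp_all add: algebra_simps)
  finally show ?case .
qed simp

primrec drift :: "walk \<Rightarrow> real"
  where "drift Simple = 0" | "drift Directed = 1"

text \<open>
  Both walks have variance \<open>s\<close> at time \<open>s\<close>; centring at an arbitrary \<open>a\<close> covers the deviation from the
  drift as well as the second moment about 0.
\<close>

lemma nn_integral_walk_law_square:
  assumes s: "s \<ge> 0"
  shows "(\<integral>\<^sup>+x. ennreal ((of_int x - a)\<^sup>2) \<partial>measure_pmf (walk_law w \<infinity> s)) = ennreal (s + (drift w * s - a)\<^sup>2)"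
proof (cases w)
  case Simple
  have "(\<integral>\<^sup>+m. ennreal (real m + a\<^sup>2) \<partial>measure_pmf (jump_count s)) = ennreal (s + a\<^sup>2)"
  proof (rule nn_integral_jump_count[OF s])
    have "(\<lambda>m. s ^ m / fact m * exp (- s) * real m + s ^ m / fact m * exp (- s) * a\<^sup>2) sums (s + 1 * a\<^sup>2)"
      by (intro sums_add sums_mult2 poisson_sums)
    then show "(\<lambda>m. s ^ m / fact m * exp (- s) * (real m + a\<^sup>2)) sums (s + a\<^sup>2)"
      by (simp add: distrib_left)
  qed simp
  then show ?thesis by (simp add: Simple walk_law_def nn_integral_jump_chain_Simple_square)
next
  case Directed
  have "(\<integral>\<^sup>+m. ennreal ((real m - a)\<^sup>2) \<partial>measure_pmf (jump_count s)) = ennreal (s + (s - a)\<^sup>2)"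
  proof (rule nn_integral_jump_count[OF s])
    have "(\<lambda>m. s ^ m / fact m * exp (- s) * (real m)\<^sup>2 + s ^ m / fact m * exp (- s) * real m * (- 2 * a)
        + s ^ m / fact m * exp (- s) * a\<^sup>2) sums (s + s\<^sup>2 + s * (- 2 * a) + 1 * a\<^sup>2)"
      by (intro sums_add sums_mult2 poisson_sums)
    then show "(\<lambda>m. s ^ m / fact m * exp (- s) * (real m - a)\<^sup>2) sums (s + (s - a)\<^sup>2)"
      by (simp add: power2_diff algebra_simps)
  qed simp
  then show ?thesis by (simp add: Directed walk_law_def jump_chain_Directed)
qed

lemma walk_law_second_moment:
  assumes s: "s \<ge> 0"
  shows "integrable (measure_pmf (walk_law w \<infinity> s)) (\<lambda>x. (of_int x - a)\<^sup>2)"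
    and "measure_pmf.expectation (walk_law w \<infinity> s) (\<lambda>x. (of_int x - a)\<^sup>2) = s + (drift w * s - a)\<^sup>2"
proof -
  show i: "integrable (measure_pmf (walk_law w \<infinity> s)) (\<lambda>x. (of_int x - a)\<^sup>2)"
    by (rule integrableI_bounded) (auto simp: nn_integral_walk_law_square[OF s])
  have "ennreal (measure_pmf.expectation (walk_law w \<infinity> s) (\<lambda>x. (of_int x - a)\<^sup>2)) = ennreal (s + (drift w * s - a)\<^sup>2)"
    using nn_integral_eq_integral[OF i] by (simp add: nn_integral_walk_law_square[OF s])
  then show "measure_pmf.expectation (walk_law w \<infinity> s) (\<lambda>x. (of_int x - a)\<^sup>2) = s + (drift w * s - a)\<^sup>2"
    using s by (subst (asm) ennreal_inj) auto
qed

section \<open>Entropy of the walk on the integers\<close>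

lemma shannon_entropy_return [simp]: "shannon_entropy (return_pmf x) = 0"
  by (simp add: shannon_entropy_expectation)

lemma walk_entropy_0 [simp]: "walk_entropy w L 0 = 0"
proof (cases L)
  case (enat l)
  then show ?thesis by (simp add: walk_entropy_def walk_law_reduce)
qed (simp add: walk_entropy_def)

lemma drift_sq_le: "s \<ge> 0 \<Longrightarrow> s + (drift w * s - 0)\<^sup>2 \<le> s + s\<^sup>2"
  by (cases w) auto

lemma abs_of_int_le_power2: "\<bar>of_int x\<bar> \<le> (of_int x :: real)\<^sup>2"
proof -
  have "\<bar>x\<bar> * 1 \<le> \<bar>x\<bar> * \<bar>x\<bar>"
  proof (cases "x = 0")
    case False
    then show ?thesis by (intro mult_left_mono) linarith+
  qed simp
  then have "of_int \<bar>x\<bar> \<le> (of_int (\<bar>x\<bar> * \<bar>x\<bar>) :: real)" by (simp only: of_int_le_iff mult_1_right)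
  then show ?thesis by (simp add: power2_eq_square)
qed

text \<open>
  Here \<open>entropy_le_entropy_map\<close> is used with a constant map, so that \<open>x\<close> itself is the missing
  information. The choice \<open>\<rho> = s\<close> will give the sharp order \<open>s ln (1 / s)\<close> for small \<open>s\<close>.
\<close>

lemma walk_entropy_infinity_upper:
  assumes s: "s \<ge> 0" and \<rho>: "0 < \<rho>" "\<rho> < 1"
  shows "integrable (measure_pmf (walk_law w \<infinity> s)) (\<lambda>x. - ln (pmf (walk_law w \<infinity> s) x))"
    and "walk_entropy w \<infinity> s \<le> - ln (1 - \<rho>) + (s + s\<^sup>2) * ln (8 / \<rho>)"
proof -
  let ?P = "walk_law w \<infinity> s"
  have m: "integrable (measure_pmf ?P) (\<lambda>x. (of_int x :: real)\<^sup>2)"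
    and e: "measure_pmf.expectation ?P (\<lambda>x. (of_int x)\<^sup>2) = s + (drift w * s - 0)\<^sup>2"
    using walk_law_second_moment[OF s, of w 0] by simp_all
  have i: "integrable (measure_pmf ?P) (\<lambda>x. \<bar>of_int x\<bar> :: real)"
    by (rule Bochner_Integration.integrable_bound[OF m])
      (use abs_of_int_le_power2 in \<open>auto simp del: power2_abs\<close>)
  have v: "measure_pmf.expectation ?P (\<lambda>x. \<bar>of_int x\<bar>) \<le> s + s\<^sup>2"
    using integral_mono[OF i m abs_of_int_le_power2] drift_sq_le[OF s, of w] unfolding e by linarith
  have inj: "inj (\<lambda>x::int. (0::int, x))" by (auto intro: injI)
  have fin: "finite (set_pmf (map_pmf (\<lambda>x. 0::int) ?P))" by auto
  note fold = entropy_le_entropy_map[where f="\<lambda>x. 0" and B="\<lambda>x. x", OF fin inj \<rho> i v]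
  from fold(1) show "integrable (measure_pmf ?P) (\<lambda>x. - ln (pmf ?P x))" .
  from fold(2) show "walk_entropy w \<infinity> s \<le> - ln (1 - \<rho>) + (s + s\<^sup>2) * ln (8 / \<rho>)"
    by (simp add: walk_entropy_def map_pmf_const)
qed

lemma walk_entropy_le_infinity:
  assumes "L > 0" "s \<ge> 0"
  shows "walk_entropy w (enat L) s \<le> walk_entropy w \<infinity> s"
  unfolding walk_entropy_def walk_law_reduce
proof (rule entropy_map_le)
  show "finite (set_pmf (map_pmf (\<lambda>x. x mod int L) (walk_law w \<infinity> s)))"
    using finite_set_walk_law[OF assms(1), of w s] unfolding walk_law_reduce .
  show "integrable (measure_pmf (walk_law w \<infinity> s)) (\<lambda>x. - ln (pmf (walk_law w \<infinity> s) x))"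
    by (rule walk_entropy_infinity_upper(1)[OF assms(2), of "1 / 2"]) auto
qed

lemma walk_entropy_dvd_le:
  assumes "L > 0" "L' dvd L"
  shows "walk_entropy w (enat L') s \<le> walk_entropy w (enat L) s"
proof -
  have "int L' dvd int L" using assms by simp
  then have eq: "walk_law w (enat L') s = map_pmf (\<lambda>x. x mod int L') (walk_law w (enat L) s)"
    by (simp add: walk_law_reduce pmf.map_comp o_def mod_mod_cancel)
  have fin: "finite (set_pmf (walk_law w (enat L) s))"
    using set_walk_law[OF assms(1)] by (meson finite_atLeastLessThan_int finite_subset)
  show ?thesis
    unfolding walk_entropy_def eq
    by (rule entropy_map_le) (use fin in \<open>auto intro: integrable_measure_pmf_finite\<close>)
qed

lemma block_inj:
  assumes "L > 0"
  shows "inj (\<lambda>x::int. (x mod int L, (x - a) div int L))"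
proof (rule injI)
  fix x y :: int
  assume "(x mod int L, (x - a) div int L) = (y mod int L, (y - a) div int L)"
  then have m: "x mod int L = y mod int L" and d: "(x - a) div int L = (y - a) div int L" by auto
  from m have "(x - a) mod int L = (y - a) mod int L" by (metis mod_diff_left_eq)
  with d have "x - a = y - a" by (metis div_mult_mod_eq)
  then show "x = y" by simp
qed

text \<open>
  Cutting the integers into blocks of length \<open>L\<close>, the central one around \<open>c\<close>, the block index
  vanishes near \<open>c\<close>. Its mean absolute value is therefore controlled by the variance divided by \<open>L\<^sup>2\<close>.
\<close>

lemma block_bound:
  fixes x a :: int and c :: real
  assumes L: "L \<ge> 4" and a: "a = \<lfloor>c - real L / 2\<rfloor>"
  shows "\<bar>of_int ((x - a) div int L)\<bar> \<le> 16 / (real L)\<^sup>2 * (of_int x - c)\<^sup>2"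
proof -
  define b where "b = (x - a) div int L"
  have L0: "real L > 0" using L by simp
  have dm: "of_int (x - a) = of_int b * real L + (of_int ((x - a) mod int L) :: real)"
    unfolding b_def by (metis div_mult_mod_eq of_int_add of_int_mult of_int_of_nat_eq)
  have L4: "real L \<ge> 4" using L by simp
  have dm': "of_int x - of_int a = real L * of_int b + (of_int ((x - a) mod int L) :: real)"
    using dm by (simp add: mult.commute)
  have "0 \<le> (x - a) mod int L" "(x - a) mod int L < int L" using L by auto
  then have r: "0 \<le> (of_int ((x - a) mod int L) :: real)" "(of_int ((x - a) mod int L) :: real) < real L"
    by linarith+
  have a': "of_int a \<le> c - real L / 2" "c - real L / 2 < of_int a + 1" unfolding a by linarith+
  have "real L * \<bar>of_int b\<bar> \<le> 4 * \<bar>of_int x - c\<bar>"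
  proof -
    consider "b = 0" | "b \<ge> 1" | "b \<le> - 1" by linarith
    then show ?thesis
    proof cases
      case 2
      then have "real L * 1 \<le> real L * of_int b" using L0 by (intro mult_left_mono) auto
      then have "of_int x - c \<ge> real L * of_int b - real L / 2 - 1" using dm' r a' by linarith
      moreover have "real L \<le> real L * of_int b" using \<open>real L * 1 \<le> real L * of_int b\<close> by simp
      ultimately have "real L * of_int b \<le> 4 * (of_int x - c)"
        using L4 unfolding right_diff_distrib by linarith
      moreover have "4 * (of_int x - c) \<le> 4 * \<bar>of_int x - c\<bar>"
        by (intro mult_left_mono abs_ge_self) simp
      moreover have "\<bar>of_int b\<bar> = (of_int b :: real)" using 2 by simp
      ultimately show ?thesis by (metis order_trans)
    next
      case 3
      have "real L * of_int b \<le> real L * (- 1)" using L0 3 by (intro mult_left_mono) auto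
      then have "- (real L * of_int b) \<le> 4 * (c - of_int x)"
        using dm' r a' L4 unfolding right_diff_distrib by linarith
      moreover have "4 * (c - of_int x) \<le> 4 * \<bar>of_int x - c\<bar>"
        by (intro mult_left_mono) (use abs_ge_minus_self[of "of_int x - c"] in auto)
      moreover have "\<bar>of_int b\<bar> = (- of_int b :: real)" using 3 by simp
      ultimately show ?thesis by (metis order_trans mult_minus_right)
    qed auto
  qed
  then have "(real L * \<bar>of_int b\<bar>)\<^sup>2 \<le> (4 * \<bar>of_int x - c\<bar>)\<^sup>2"
    by (intro power_mono) auto
  then have "(real L)\<^sup>2 * (of_int b)\<^sup>2 \<le> 16 * (of_int x - c)\<^sup>2"
    by (simp add: power_mult_distrib)
  moreover have "(real L)\<^sup>2 * \<bar>of_int b\<bar> \<le> (real L)\<^sup>2 * (of_int b)\<^sup>2"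
    by (intro mult_left_mono abs_of_int_le_power2) auto
  ultimately have "(real L)\<^sup>2 * \<bar>of_int b\<bar> \<le> 16 * (of_int x - c)\<^sup>2" by linarith
  then show ?thesis using L0 by (simp add: b_def field_simps)
qed

text \<open>
  If \<open>L\<close> is a large multiple of the standard deviation \<open>sqrt s\<close>, then the block around the drift that
  contains the walk is almost determined, so reduction modulo \<open>L\<close> loses almost no entropy.
\<close>

lemma walk_entropy_infinity_le_cycle:
  assumes g: "g > 0"
  obtains A where "A > 0"
    "\<And>w L s. s \<ge> 0 \<Longrightarrow> L \<ge> 4 \<Longrightarrow> real L \<ge> A * sqrt s \<Longrightarrow> walk_entropy w \<infinity> s \<le> walk_entropy w (enat L) s + g"
proof -
  define \<rho> where "\<rho> = 1 - exp (- g / 2)"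
  have \<rho>: "0 < \<rho>" "\<rho> < 1" using g by (auto simp: \<rho>_def)
  define l where "l = ln (8 / \<rho>)"
  have l: "l > 0" using \<rho> by (auto simp: l_def)
  \<comment> \<open>The mean absolute block index is at most \<open>16 s / L\<^sup>2 \<le> 16 / A\<^sup>2\<close>, which costs \<open>16 l / A\<^sup>2 = g / 2\<close>.\<close>
  define A where "A = sqrt (32 * l / g)"
  have A: "A > 0" "A\<^sup>2 = 32 * l / g" using l g by (auto simp: A_def)
  have "walk_entropy w \<infinity> s \<le> walk_entropy w (enat L) s + g"
    if s: "s \<ge> 0" and L: "L \<ge> 4" and LA: "real L \<ge> A * sqrt s" for w L s
  proof -
    let ?P = "walk_law w \<infinity> s"
    define c where "c = drift w * s"
    define a where "a = \<lfloor>c - real L / 2\<rfloor>"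
    let ?B = "\<lambda>x. (x - a) div int L"
    have L0: "L > 0" using L by simp
    have m: "integrable (measure_pmf ?P) (\<lambda>x. 16 / (real L)\<^sup>2 * (of_int x - c)\<^sup>2)"
      and e: "measure_pmf.expectation ?P (\<lambda>x. 16 / (real L)\<^sup>2 * (of_int x - c)\<^sup>2) = 16 / (real L)\<^sup>2 * s"
      using walk_law_second_moment[OF s, of w c] by (simp_all add: c_def)
    note b = block_bound[OF L a_def]
    have i: "integrable (measure_pmf ?P) (\<lambda>x. \<bar>of_int (?B x)\<bar> :: real)"
      by (rule Bochner_Integration.integrable_bound[OF m]) (use b in auto)
    have v: "measure_pmf.expectation ?P (\<lambda>x. \<bar>of_int (?B x)\<bar>) \<le> 16 / (real L)\<^sup>2 * s"
      using integral_mono[OF i m b] unfolding e .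
    have fin: "finite (set_pmf (map_pmf (\<lambda>x. x mod int L) ?P))"
      using finite_set_walk_law[OF L0, of w s] unfolding walk_law_reduce .
    have "walk_entropy w \<infinity> s \<le> walk_entropy w (enat L) s - ln (1 - \<rho>) + 16 / (real L)\<^sup>2 * s * l"
      using entropy_le_entropy_map(2)[OF fin block_inj[OF L0] \<rho> i v]
      by (simp add: walk_entropy_def walk_law_reduce l_def)
    moreover have "- ln (1 - \<rho>) = g / 2" by (simp add: \<rho>_def)
    moreover have "16 / (real L)\<^sup>2 * s * l \<le> g / 2"
    proof -
      have "(A * sqrt s)\<^sup>2 \<le> (real L)\<^sup>2" using LA A s by (intro power_mono) auto
      then have "32 * l / g * s \<le> (real L)\<^sup>2" using s by (simp add: power_mult_distrib A(2))
      then have "32 * l * s \<le> g * (real L)\<^sup>2" using g by (simp add: field_simps)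
      then show ?thesis using L0 by (simp add: field_simps)
    qed
    ultimately show ?thesis by linarith
  qed
  with A(1) show thesis by (rule that)
qed

text \<open>
  The angle \<open>2 \<pi> / J\<close> is available on every cycle whose length is a multiple of \<open>J\<close>, and the entropies of
  these cycles approximate the entropy on the integers.
\<close>

lemma walk_entropy_infinity_increment:
  assumes J: "J > 0" and s: "s \<ge> 0" and t: "t \<ge> 0"
  defines "u \<equiv> 1 - cos (2 * pi / real J)"
  shows "walk_entropy w \<infinity> s + exp (- 2 * s * u) * (1 - exp (- 2 * t * u)) / 4 \<le> walk_entropy w \<infinity> (s + t)"
proof (rule field_le_epsilon)
  fix g :: real assume "g > 0"
  then obtain A where A: "\<And>w L s. s \<ge> 0 \<Longrightarrow> L \<ge> 4 \<Longrightarrow> real L \<ge> A * sqrt s \<Longrightarrow> walk_entropy w \<infinity> s \<le> walk_entropy w (enat L) s + g"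
    by (rule walk_entropy_infinity_le_cycle) blast
  define i where "i = nat \<lceil>A * sqrt s\<rceil> + 4"
  \<comment> \<open>The frequency \<open>i\<close> on the cycle of length \<open>J i\<close> has the angle \<open>2 \<pi> / J\<close>.\<close>
  define L where "L = J * i"
  have "i \<le> L" using J by (simp add: L_def)
  moreover have "real i \<ge> A * sqrt s" "i \<ge> 4" unfolding i_def by linarith+
  ultimately have L: "L \<ge> 4" "real L \<ge> A * sqrt s" by linarith+
  have ang: "2 * pi * real i / real L = 2 * pi / real J"
    using \<open>i \<ge> 4\<close> J by (simp add: L_def)
  have "walk_entropy w \<infinity> s \<le> walk_entropy w (enat L) s + g" by (rule A[OF s L])
  moreover have "walk_entropy w (enat L) s + exp (- 2 * s * u) * (1 - exp (- 2 * t * u)) / 4 \<le> walk_entropy w (enat L) (s + t)"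
    using walk_entropy_increment[of L s t w i] L s t unfolding ang u_def by simp
  moreover have "walk_entropy w (enat L) (s + t) \<le> walk_entropy w \<infinity> (s + t)"
    using L s t by (intro walk_entropy_le_infinity) auto
  ultimately show "walk_entropy w \<infinity> s + exp (- 2 * s * u) * (1 - exp (- 2 * t * u)) / 4 \<le> walk_entropy w \<infinity> (s + t) + g"
    by linarith
qed

lemma one_minus_cos: "1 - cos x = 2 * (sin (x / 2))\<^sup>2" for x :: real
  using cos_double_sin[of "x / 2"] by simp

lemma one_minus_cos_root_pos:
  assumes "0 < j" "j < L"
  shows "1 - cos (2 * pi * real j / real L) > 0"
proof -
  have "0 < sin (pi * real j / real L)"
    using assms by (intro sin_gt_zero) (auto simp: field_simps)
  then show ?thesis unfolding one_minus_cos by simp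
qed

lemma increment_pos:
  assumes "0 \<le> s" "s < t" "0 < u"
  shows "0 < exp (- 2 * s * u) * (1 - exp (- 2 * (t - s) * u)) / (4 :: real)"
proof -
  have "0 < (t - s) * u" using assms by simp
  then have "- 2 * (t - s) * u < 0" unfolding mult.assoc by linarith
  then have "exp (- 2 * (t - s) * u) < 1" by (simp only: exp_less_one_iff)
  then show ?thesis by simp
qed

lemma walk_entropy_strict_mono:
  assumes L: "L \<ge> 2" and st: "0 \<le> s" "s < t"
  shows "walk_entropy w L s < walk_entropy w L t"
proof (cases L)
  case (enat l)
  with L have l: "l \<ge> 2" by (simp add: numeral_eq_enat)
  have "1 - cos (2 * pi * real 1 / real l) > 0" using l by (intro one_minus_cos_root_pos) auto
  from increment_pos[OF st this] show ?thesis
    using walk_entropy_increment[of l s "t - s" w 1] l st unfolding enat by simp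
next
  case infinity
  have u: "1 - cos (2 * pi / real 2) > 0" by simp
  have "walk_entropy w \<infinity> s + exp (- 2 * s * (1 - cos (2 * pi / real 2)))
      * (1 - exp (- 2 * (t - s) * (1 - cos (2 * pi / real 2)))) / 4 \<le> walk_entropy w \<infinity> (s + (t - s))"
    by (rule walk_entropy_infinity_increment) (use st in auto)
  moreover have "s + (t - s) = t" by simp
  ultimately show ?thesis using increment_pos[OF st u] unfolding infinity by simp
qed

lemma walk_entropy_mono:
  assumes "L \<ge> 2" "0 \<le> s" "s \<le> t"
  shows "walk_entropy w L s \<le> walk_entropy w L t"
  using walk_entropy_strict_mono[OF assms(1,2), of t w] assms(3) by (cases "s = t") auto

lemma walk_entropy_le_iff:
  assumes "L \<ge> 2" "0 \<le> s" "0 \<le> t"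
  shows "walk_entropy w L s \<le> walk_entropy w L t \<longleftrightarrow> s \<le> t"
  using walk_entropy_strict_mono[OF assms(1,3), of s w] walk_entropy_mono[OF assms(1,2), of t w]
  by (meson linorder_not_le)

lemma walk_entropy_eventually_gt:
  assumes L: "L > 0" and y: "y < ln (real L)"
  shows "\<forall>\<^sub>F s in at_top. y < walk_entropy w (enat L) s"
proof -
  define S where "S s = (\<Sum>j<L. exp (- s * (1 - cos (2 * pi * real j / real L))))" for s :: real
  have term_lim: "((\<lambda>s. exp (- s * (1 - cos (2 * pi * real j / real L)))) \<longlongrightarrow> (if j = 0 then 1 else 0)) at_top"
    if "j < L" for j
  proof (cases "j = 0")
    case False
    then have "1 - cos (2 * pi * real j / real L) > 0" using that by (intro one_minus_cos_root_pos) auto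
    then have "((\<lambda>s. exp (- s * (1 - cos (2 * pi * real j / real L)))) \<longlongrightarrow> 0) at_top"
      by real_asymp
    with False show ?thesis by simp
  qed auto
  have "(S \<longlongrightarrow> (\<Sum>j<L. if j = 0 then 1 else 0)) at_top"
    unfolding S_def by (intro tendsto_sum term_lim) auto
  also have "(\<Sum>j<L. if j = 0 then 1 else 0 :: real) = 1" using L by (subst sum.delta) auto
  finally have "((\<lambda>s. ln (real L) - ln (S s)) \<longlongrightarrow> ln (real L) - ln 1) at_top"
    by (intro tendsto_intros) auto
  then have "\<forall>\<^sub>F s in at_top. y < ln (real L) - ln (S s)"
    using y by (intro order_tendstoD(1)) auto
  then show ?thesis
    using eventually_ge_at_top[of 0]
  proof eventually_elim
    case (elim s)
    then show ?case using walk_entropy_ge_fourier[OF L, of s w] unfolding S_def by linarith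
  qed
qed

lemma walk_entropy_infinity_eventually_gt: "\<forall>\<^sub>F s in at_top. y < walk_entropy w \<infinity> s"
proof -
  define L where "L = nat \<lceil>exp y\<rceil> + 1"
  have "L > 0" by (simp add: L_def)
  have "exp y < real L" unfolding L_def by linarith
  then have "y < ln (real L)" using \<open>L > 0\<close> by (metis exp_less_cancel_iff exp_ln of_nat_0_less_iff)
  from walk_entropy_eventually_gt[OF \<open>L > 0\<close> this, of w] eventually_ge_at_top[of 0] show ?thesis
  proof eventually_elim
    case (elim s)
    then show ?case using walk_entropy_le_infinity[OF \<open>L > 0\<close>, of s w] by linarith
  qed
qed

lemma continuous_on_walk_entropy_infinity: "continuous_on {0..S} (walk_entropy w \<infinity>)"
proof (rule uniform_limit_theorem)
  show "\<forall>\<^sub>F L in sequentially. continuous_on {0..S} (walk_entropy w (enat L))"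
    using eventually_gt_at_top[of 0]
    by eventually_elim (rule continuous_on_subset[OF continuous_on_walk_entropy], auto)
  show "uniform_limit {0..S} (\<lambda>L. walk_entropy w (enat L)) (walk_entropy w \<infinity>) sequentially"
    unfolding uniform_limit_iff
  proof (intro allI impI)
    fix e :: real assume "e > 0"
    then have "e / 2 > 0" by simp
    then obtain A where A: "A > 0" "\<And>w L s. s \<ge> 0 \<Longrightarrow> L \<ge> 4 \<Longrightarrow> real L \<ge> A * sqrt s \<Longrightarrow> walk_entropy w \<infinity> s \<le> walk_entropy w (enat L) s + e / 2"
      by (rule walk_entropy_infinity_le_cycle) blast
    show "\<forall>\<^sub>F L in sequentially. \<forall>s\<in>{0..S}. dist (walk_entropy w (enat L) s) (walk_entropy w \<infinity> s) < e"
      using eventually_ge_at_top[of "nat \<lceil>A * sqrt S\<rceil> + 4"]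
    proof eventually_elim
      case (elim L)
      show ?case
      proof
        fix s assume s: "s \<in> {0..S}"
        then have "A * sqrt s \<le> A * sqrt S" using A(1) by simp
        also have "\<dots> \<le> real L" using elim by linarith
        finally have "walk_entropy w \<infinity> s \<le> walk_entropy w (enat L) s + e / 2"
          using s elim by (intro A(2)) auto
        moreover have "walk_entropy w (enat L) s \<le> walk_entropy w \<infinity> s"
          using s elim by (intro walk_entropy_le_infinity) auto
        ultimately show "dist (walk_entropy w (enat L) s) (walk_entropy w \<infinity> s) < e"
          using \<open>e > 0\<close> by (simp add: dist_real_def)
      qed
    qed
  qed
qed simp

lemma walk_entropy_surj:
  assumes y: "0 \<le> y" "\<And>l. L = enat l \<Longrightarrow> 0 < l \<and> y < ln (real l)"
  obtains s where "s \<ge> 0" "walk_entropy w L s = y"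
proof -
  have "\<forall>\<^sub>F s in at_top. y < walk_entropy w L s"
    using walk_entropy_eventually_gt walk_entropy_infinity_eventually_gt y(2) by (cases L) auto
  then have "\<forall>\<^sub>F s in at_top. y < walk_entropy w L s \<and> 0 \<le> s"
    using eventually_ge_at_top[of 0] by eventually_elim auto
  then obtain S where S: "y < walk_entropy w L S" "0 \<le> S"
    using eventually_happens'[OF trivial_limit_at_top_linorder] by blast
  have "continuous_on {0..S} (walk_entropy w L)"
    using continuous_on_walk_entropy_infinity continuous_on_subset[OF continuous_on_walk_entropy, of _ "{0..S}"] y(2)
    by (cases L) auto
  from IVT'[OF _ _ S(2) this, of y] S y(1) show thesis using that by auto
qed

lemma inv_walk_entropy:
  assumes "0 \<le> y" "\<And>l. L = enat l \<Longrightarrow> 0 < l \<and> y < ln (real l)"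
  shows "inv_into {0..} (walk_entropy w L) y \<ge> 0"
    and "walk_entropy w L (inv_into {0..} (walk_entropy w L) y) = y"
proof -
  obtain s where "s \<ge> 0" "walk_entropy w L s = y" using walk_entropy_surj[OF assms] by blast
  then have "y \<in> walk_entropy w L ` {0..}" by auto
  from inv_into_into[OF this] f_inv_into_f[OF this]
  show "inv_into {0..} (walk_entropy w L) y \<ge> 0"
    and "walk_entropy w L (inv_into {0..} (walk_entropy w L) y) = y" by auto
qed

section \<open>Uniform comparison of the cycles with the integers\<close>

lemma prob_walk_nonzero_le:
  assumes s: "s \<ge> 0"
  shows "measure_pmf.prob (walk_law w \<infinity> s) (- {0}) \<le> s + s\<^sup>2"
proof -
  let ?P = "walk_law w \<infinity> s"
  have m: "integrable (measure_pmf ?P) (\<lambda>x. (of_int x :: real)\<^sup>2)"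
    and e: "measure_pmf.expectation ?P (\<lambda>x. (of_int x)\<^sup>2) = s + (drift w * s - 0)\<^sup>2"
    using walk_law_second_moment[OF s, of w 0] by simp_all
  have "measure_pmf.prob ?P (- {0}) = measure_pmf.expectation ?P (indicator (- {0}))" by simp
  also have "\<dots> \<le> measure_pmf.expectation ?P (\<lambda>x. (of_int x)\<^sup>2)"
  proof (rule integral_mono[OF _ m])
    fix x :: int
    have "1 \<le> \<bar>of_int x :: real\<bar>" if "x \<noteq> 0" using that by linarith
    then show "indicator (- {0}) x \<le> (of_int x :: real)\<^sup>2"
      using abs_of_int_le_power2[of x] by (fastforce simp: indicator_def)
  qed (simp add: measure_pmf.emeasure_eq_measure)
  also have "\<dots> \<le> s + s\<^sup>2" using drift_sq_le[OF s] unfolding e .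
  finally show ?thesis .
qed

text \<open>
  A single jump leads away from 0 because \<open>L \<ge> 2\<close>.
\<close>

lemma prob_walk_mod_nonzero_ge:
  assumes L: "L \<ge> 2" and t: "t > 0"
  shows "t * exp (- t) \<le> measure_pmf.prob (walk_law w (enat L) t) (- {0})"
proof -
  have one: "emeasure (measure_pmf (jump_chain w (enat L) 1)) (- {0}) = 1"
  proof -
    have "AE x in measure_pmf (jump_chain w (enat L) 1). x \<in> - {0}"
      using L by (cases w) (auto simp: AE_measure_pmf_iff bind_return_pmf zmod_minus1)
    then show ?thesis by (intro measure_pmf.emeasure_eq_1_AE) auto
  qed
  have "ennreal (t * exp (- t)) = emeasure (measure_pmf (jump_count t)) {1}"
    using t by (simp add: emeasure_pmf_single pmf_jump_count)
  also have "\<dots> = (\<integral>\<^sup>+m. indicator {1} m \<partial>measure_pmf (jump_count t))" by simp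
  also have "\<dots> \<le> (\<integral>\<^sup>+m. emeasure (measure_pmf (jump_chain w (enat L) m)) (- {0}) \<partial>measure_pmf (jump_count t))"
    by (rule nn_integral_mono) (use one in \<open>auto simp: indicator_def\<close>)
  also have "\<dots> = emeasure (measure_pmf (walk_law w (enat L) t)) (- {0})"
    unfolding walk_law_def by (rule emeasure_bind_pmf[symmetric])
  also have "\<dots> = ennreal (measure_pmf.prob (walk_law w (enat L) t) (- {0}))"
    by (rule measure_pmf.emeasure_eq_measure)
  finally show ?thesis by simp
qed

text \<open>
  Every point other than 0 has mass at most \<open>t + t\<^sup>2\<close>, while together they carry mass of order \<open>t\<close>.
  The bound does not depend on \<open>L\<close>.
\<close>

lemma walk_entropy_short_time_ge:
  assumes L: "L \<ge> 2" and t: "t > 0" and t1: "t + t\<^sup>2 \<le> 1"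
  shows "t * exp (- t) * ln (1 / (t + t\<^sup>2)) \<le> walk_entropy w (enat L) t"
proof -
  let ?P = "walk_law w (enat L) t"
  have L0: "L > 0" using L by simp
  have fin: "finite (set_pmf ?P)"
    by (rule finite_set_walk_law[OF L0])
  have tt: "t + t\<^sup>2 > 0" using t by (simp add: add_pos_pos)
  have l: "ln (1 / (t + t\<^sup>2)) \<ge> 0" using tt t1 by simp
  have small: "pmf ?P r \<le> t + t\<^sup>2" if "r \<noteq> 0" for r
  proof -
    have "pmf ?P r = measure_pmf.prob (walk_law w \<infinity> t) ((\<lambda>x. x mod int L) -` {r})"
      by (simp add: walk_law_reduce pmf_map)
    also have "\<dots> \<le> measure_pmf.prob (walk_law w \<infinity> t) (- {0})"
      by (rule measure_pmf.finite_measure_mono) (use that in auto)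
    also have "\<dots> \<le> t + t\<^sup>2" using t by (intro prob_walk_nonzero_le) simp
    finally show ?thesis .
  qed
  have "t * exp (- t) * ln (1 / (t + t\<^sup>2)) \<le> measure_pmf.prob ?P (- {0}) * ln (1 / (t + t\<^sup>2))"
    by (intro mult_right_mono prob_walk_mod_nonzero_ge L t l)
  also have "\<dots> = measure_pmf.expectation ?P (\<lambda>x. indicator (- {0}) x * ln (1 / (t + t\<^sup>2)))"
    by simp
  also have "\<dots> \<le> measure_pmf.expectation ?P (\<lambda>x. - ln (pmf ?P x))"
  proof (rule integral_mono_AE)
    show "AE x in measure_pmf ?P. indicator (- {0}) x * ln (1 / (t + t\<^sup>2)) \<le> - ln (pmf ?P x)"
    proof (rule AE_pmfI)
      fix x assume "x \<in> set_pmf ?P"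
      then have pos: "pmf ?P x > 0" by (simp add: pmf_positive)
      show "indicator (- {0}) x * ln (1 / (t + t\<^sup>2)) \<le> - ln (pmf ?P x)"
      proof (cases "x = 0")
        case False
        then have "ln (pmf ?P x) \<le> ln (t + t\<^sup>2)" using small[of x] pos by (intro ln_mono) auto
        then show ?thesis using False tt by (simp add: ln_div)
      qed (use pos pmf_le_1[of ?P x] in auto)
    qed
  qed (intro integrable_measure_pmf_finite fin)+
  finally show ?thesis by (simp add: walk_entropy_def shannon_entropy_expectation)
qed

text \<open>
  For small \<open>s\<close> the leading terms are \<open>s ln (1 / s)\<close> on the integers and \<open>(1 + e) s ln (1 / s)\<close> on each
  cycle.
\<close>

lemma walk_entropy_short_time:
  assumes e: "e > 0"
  obtains s0 where "s0 > 0"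
    "\<And>w L s. 0 < s \<Longrightarrow> s \<le> s0 \<Longrightarrow> L \<ge> 2 \<Longrightarrow> walk_entropy w \<infinity> s \<le> walk_entropy w (enat L) ((1 + e) * s)"
proof -
  have "\<forall>\<^sub>F s in at_right 0. - ln (1 - s) + (s + s\<^sup>2) * ln (8 / s)
      \<le> (1 + e) * s * exp (- ((1 + e) * s)) * ln (1 / ((1 + e) * s + ((1 + e) * s)\<^sup>2))"
    using e by real_asymp
  moreover have "\<forall>\<^sub>F s in at_right (0::real). s < 1" by real_asymp
  moreover have "\<forall>\<^sub>F s in at_right 0. (1 + e) * s + ((1 + e) * s)\<^sup>2 \<le> 1"
    using e by real_asymp
  ultimately have "\<forall>\<^sub>F s in at_right 0. s < 1 \<and> (1 + e) * s + ((1 + e) * s)\<^sup>2 \<le> 1 \<and>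
      - ln (1 - s) + (s + s\<^sup>2) * ln (8 / s)
      \<le> (1 + e) * s * exp (- ((1 + e) * s)) * ln (1 / ((1 + e) * s + ((1 + e) * s)\<^sup>2))"
    by eventually_elim auto
  then obtain b where b: "b > 0" and B: "\<And>s. 0 < s \<Longrightarrow> s < b \<Longrightarrow> s < 1 \<and> (1 + e) * s + ((1 + e) * s)\<^sup>2 \<le> 1 \<and>
      - ln (1 - s) + (s + s\<^sup>2) * ln (8 / s)
      \<le> (1 + e) * s * exp (- ((1 + e) * s)) * ln (1 / ((1 + e) * s + ((1 + e) * s)\<^sup>2))"
    unfolding eventually_at_right_field by auto
  have "walk_entropy w \<infinity> s \<le> walk_entropy w (enat L) ((1 + e) * s)"
    if s: "0 < s" "s \<le> b / 2" and L: "L \<ge> 2" for w L s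
  proof -
    have B': "s < 1" "(1 + e) * s + ((1 + e) * s)\<^sup>2 \<le> 1"
      "- ln (1 - s) + (s + s\<^sup>2) * ln (8 / s)
      \<le> (1 + e) * s * exp (- ((1 + e) * s)) * ln (1 / ((1 + e) * s + ((1 + e) * s)\<^sup>2))"
      using B[of s] s b by auto
    have "(1 + e) * s > 0" using e s by simp
    from walk_entropy_short_time_ge[OF L this B'(2), of w] walk_entropy_infinity_upper(2)[OF _ s(1) B'(1), of s w] B'(3) s
    show ?thesis by linarith
  qed
  with b show thesis using that[of "b / 2"] by simp
qed

text \<open>
  From \<open>y cos y \<le> sin y\<close> and the double angle formula, \<open>sin x \<ge> x cos\<^sup>2 (x / 2)\<close>, and the square is at
  least one half.
\<close>

lemma sin_ge_half:
  fixes x :: real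
  assumes "0 \<le> x" "x \<le> pi / 2"
  shows "x / 2 \<le> sin x"
proof -
  define y where "y = x / 2"
  have y: "0 \<le> y" "y \<le> pi / 4" using assms by (auto simp: y_def)
  have "(\<lambda>z. sin z - z * cos z) 0 \<le> (\<lambda>z. sin z - z * cos z) y"
  proof (rule DERIV_nonneg_imp_nondecreasing[OF y(1)])
    fix z assume z: "0 \<le> z" "z \<le> y"
    have "((\<lambda>z. sin z - z * cos z) has_real_derivative z * sin z) (at z)"
      by (auto intro!: derivative_eq_intros)
    moreover have "0 \<le> z * sin z" using z y pi_gt_zero by (intro mult_nonneg_nonneg sin_ge_zero) linarith+
    ultimately show "\<exists>d. ((\<lambda>z. sin z - z * cos z) has_real_derivative d) (at z) \<and> 0 \<le> d" by blast
  qed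
  then have s: "y * cos y \<le> sin y" by simp
  have c: "0 \<le> cos y" using y pi_gt_zero by (intro cos_ge_zero) linarith+
  have "0 \<le> cos x" using assms by (intro cos_ge_zero) auto
  then have "1 \<le> 2 * (cos y)\<^sup>2" using cos_double_cos[of y] by (simp add: y_def)
  then have "y * 1 \<le> y * (2 * (cos y)\<^sup>2)" using y by (intro mult_left_mono) auto
  also have "\<dots> = 2 * (y * cos y) * cos y" by (simp add: power2_eq_square)
  also have "\<dots> \<le> 2 * sin y * cos y" using s c by (intro mult_right_mono) auto
  also have "\<dots> = sin x" using sin_double[of y] by (simp add: y_def)
  finally show ?thesis by (simp add: y_def)
qed

lemma one_minus_cos_root_ge:
  assumes j: "2 * j \<le> L" "L > 0"
  shows "2 * (real j / real L)\<^sup>2 \<le> 1 - cos (2 * pi * real j / real L)"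
proof -
  define x where "x = pi * real j / real L"
  have rl: "2 * real j \<le> real L" using j by linarith
  have x: "0 \<le> x" "x \<le> pi / 2"
  proof -
    show "0 \<le> x" by (simp add: x_def)
    have "pi * (2 * real j) \<le> pi * real L" using rl by (intro mult_left_mono) auto
    then show "x \<le> pi / 2" using j(2) by (simp add: x_def field_simps)
  qed
  have "2 * (real j / real L) \<le> pi * (real j / real L)" 
    using pi_ge_two by (intro mult_right_mono) auto
  then have "real j / real L \<le> x / 2" by (simp add: x_def)
  also have "\<dots> \<le> sin x" by (rule sin_ge_half[OF x])
  finally have a: "real j / real L \<le> sin x" .
  have "(real j / real L)\<^sup>2 \<le> (sin x)\<^sup>2" using a by (intro power_mono) auto
  moreover have "1 - cos (2 * pi * real j / real L) = 2 * (sin x)\<^sup>2"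
    unfolding one_minus_cos by (simp add: x_def)
  ultimately show ?thesis by simp
qed

lemma cos_root_reflect:
  assumes "j \<le> L" "L > 0"
  shows "cos (2 * pi * real (L - j) / real L) = cos (2 * pi * real j / real L)"
proof -
  have "2 * pi * real (L - j) / real L = 2 * pi - 2 * pi * real j / real L"
    using assms by (simp add: of_nat_diff field_simps)
  then show ?thesis by (simp add: cos_diff)
qed

text \<open>
  When \<open>L\<close> is at most of order \<open>sqrt t\<close>, the sum in \<open>walk_entropy_ge_fourier\<close> is dominated by two
  geometric series, one for the frequencies near 0 and one for those near \<open>L\<close>.
\<close>

lemma walk_entropy_diffusive_ge:
  assumes A: "A > 0"
  obtains C where "C \<ge> 0"
    "\<And>w L t. t \<ge> 0 \<Longrightarrow> L > 0 \<Longrightarrow> real L \<le> A * sqrt t \<Longrightarrow> ln (real L) - C \<le> walk_entropy w (enat L) t"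
proof -
  define q where "q = exp (- 2 / A\<^sup>2)"
  have q: "0 < q" "q < 1" using A by (auto simp: q_def)
  define K where "K = 2 / (1 - q)"
  have K: "K \<ge> 1" using q by (simp add: K_def field_simps)
  have geo: "(\<Sum>j<n. q ^ j) \<le> 1 / (1 - q)" for n
  proof -
    have "(\<Sum>j<n. q ^ j) = (1 - q ^ n) / (1 - q)" using q by (simp add: sum_gp_strict)
    also have "\<dots> \<le> 1 / (1 - q)" using q by (intro divide_right_mono) auto
    finally show ?thesis .
  qed
  have "ln (real L) - ln K \<le> walk_entropy w (enat L) t"
    if t: "t \<ge> 0" and L: "L > 0" and LA: "real L \<le> A * sqrt t" for w L t
  proof -
    have half: "exp (- t * (1 - cos (2 * pi * real j / real L))) \<le> q ^ j" if j: "2 * j \<le> L" for j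
    proof -
      have "(real L)\<^sup>2 \<le> (A * sqrt t)\<^sup>2" using LA by (intro power_mono) auto
      then have "(real L)\<^sup>2 \<le> A\<^sup>2 * t" using t by (simp add: power_mult_distrib)
      then have "1 / A\<^sup>2 \<le> t / (real L)\<^sup>2" using A L by (simp add: field_simps)
      then have "2 * (real j)\<^sup>2 * (1 / A\<^sup>2) \<le> 2 * (real j)\<^sup>2 * (t / (real L)\<^sup>2)"
        by (intro mult_left_mono) auto
      also have "\<dots> = t * (2 * (real j / real L)\<^sup>2)" by (simp add: power_divide)
      also have "\<dots> \<le> t * (1 - cos (2 * pi * real j / real L))"
        using one_minus_cos_root_ge[OF j L] t by (rule mult_left_mono)
      finally have "2 * (real j)\<^sup>2 * (1 / A\<^sup>2) \<le> t * (1 - cos (2 * pi * real j / real L))" .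
      moreover have "real j \<le> (real j)\<^sup>2" using abs_of_int_le_power2[of "int j"] by simp
      then have "2 * real j * (1 / A\<^sup>2) \<le> 2 * (real j)\<^sup>2 * (1 / A\<^sup>2)"
        by (intro mult_right_mono) auto
      ultimately have "2 * real j * (1 / A\<^sup>2) \<le> t * (1 - cos (2 * pi * real j / real L))"
        by linarith
      then have "exp (- t * (1 - cos (2 * pi * real j / real L))) \<le> exp (- (2 * real j * (1 / A\<^sup>2)))"
        by simp
      also have "- (2 * real j * (1 / A\<^sup>2)) = real j * (- 2 / A\<^sup>2)" by simp
      finally have "exp (- t * (1 - cos (2 * pi * real j / real L))) \<le> exp (real j * (- 2 / A\<^sup>2))" .
      also have "\<dots> = q ^ j" by (simp only: q_def exp_of_nat_mult)
      finally show ?thesis .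
    qed
    have "(\<Sum>j<L. exp (- t * (1 - cos (2 * pi * real j / real L)))) \<le> (\<Sum>j<L. q ^ j + q ^ (L - 1 - j))"
    proof (rule sum_mono)
      fix j assume "j \<in> {..<L}"
      then have j: "j < L" by simp
      show "exp (- t * (1 - cos (2 * pi * real j / real L))) \<le> q ^ j + q ^ (L - 1 - j)"
      proof (cases "2 * j \<le> L")
        case True
        from half[OF this] show ?thesis using q by (simp add: add_increasing2)
      next
        case False
        then have "2 * (L - j) \<le> L" by simp
        from half[OF this] have "exp (- t * (1 - cos (2 * pi * real j / real L))) \<le> q ^ (L - j)"
          using cos_root_reflect[of j L] j L by simp
        also have "\<dots> \<le> q ^ (L - 1 - j)" using q by (intro power_decreasing) auto
        finally show ?thesis using q by (simp add: add_increasing)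
      qed
    qed
    also have "\<dots> = (\<Sum>j<L. q ^ j) + (\<Sum>j<L. q ^ j)"
      using sum.nat_diff_reindex[of "\<lambda>j. q ^ j" L] by (simp add: sum.distrib)
    also have "\<dots> \<le> K" using geo[of L] by (simp add: K_def)
    finally have le: "(\<Sum>j<L. exp (- t * (1 - cos (2 * pi * real j / real L)))) \<le> K" .
    have "0 < (\<Sum>j<L. exp (- t * (1 - cos (2 * pi * real j / real L))))"
      using L by (intro sum_pos) auto
    with le have "ln (\<Sum>j<L. exp (- t * (1 - cos (2 * pi * real j / real L)))) \<le> ln K"
      by (intro ln_mono) auto
    then show ?thesis using walk_entropy_ge_fourier[OF L t, of w] by linarith
  qed
  then show thesis using K by (intro that[of "ln K"]) auto
qed

text \<open>
  In \<open>walk_entropy_infinity_increment\<close> the angle \<open>2 \<pi> / J\<close> with \<open>J\<close> close to \<open>sqrt s\<close> makes both \<open>s u\<close>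
  bounded and \<open>e s u\<close> bounded away from 0.
\<close>

lemma walk_entropy_infinity_gap:
  assumes e: "e > 0" and s0: "s0 > 0"
  obtains g where "g > 0"
    "\<And>w s. s \<ge> s0 \<Longrightarrow> walk_entropy w \<infinity> s + g \<le> walk_entropy w \<infinity> ((1 + e) * s)"
proof -
  define \<kappa> where "\<kappa> = 4 * e * (sqrt s0 / (sqrt s0 + 2))\<^sup>2"
  define g where "g = exp (- 64) * (1 - exp (- \<kappa>)) / 4"
  have "sqrt s0 / (sqrt s0 + 2) > 0" using s0 by (intro divide_pos_pos add_pos_pos) auto
  then have "\<kappa> > 0" using e unfolding \<kappa>_def by (intro mult_pos_pos zero_less_power) auto
  then have "g > 0" by (simp add: g_def)
  moreover have "walk_entropy w \<infinity> s + g \<le> walk_entropy w \<infinity> ((1 + e) * s)" if s: "s \<ge> s0" for w s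
  proof -
    \<comment> \<open>The summand 1 ensures \<open>J \<ge> 2\<close>; for \<open>J = 1\<close> the angle would be trivial.\<close>
    define J where "J = nat \<lceil>sqrt s\<rceil> + 1"
    have sq: "sqrt s \<ge> sqrt s0" "sqrt s0 > 0" using s s0 by auto
    have J: "sqrt s \<le> real J" "real J \<le> sqrt s + 2" "2 \<le> J"
      using sq unfolding J_def by (linarith | simp)+
    define u where "u = 1 - cos (2 * pi / real J)"
    have "2 * (1 / real J)\<^sup>2 \<le> u"
      using one_minus_cos_root_ge[of 1 J] J(3) by (simp add: u_def)
    have u_le: "u \<le> 32 / (real J)\<^sup>2"
    proof -
      have "sin (pi / real J) \<le> pi / real J" using J(3) by (intro sin_x_le_x) auto
      also have "\<dots> \<le> 4 / real J" using pi_less_4 by (intro divide_right_mono) auto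
      finally have "sin (pi / real J) \<le> 4 / real J" .
      moreover have "0 \<le> sin (pi / real J)" using J(3) by (intro sin_ge_zero) (auto simp: field_simps)
      ultimately have "(sin (pi / real J))\<^sup>2 \<le> (4 / real J)\<^sup>2" by (intro power_mono)
      then show ?thesis by (simp add: u_def one_minus_cos power_divide)
    qed
    have "s \<le> (real J)\<^sup>2" using J(1) s s0 real_le_rsqrt[of s] 
      by (metis order_less_imp_le order_trans real_sqrt_ge_zero real_sqrt_pow2 power_mono)
    have su: "s * u \<le> 32"
    proof -
      have "s * u \<le> s * (32 / (real J)\<^sup>2)" using u_le s s0 by (intro mult_left_mono) auto
      also have "\<dots> = 32 * (s / (real J)\<^sup>2)" by simp
      also have "\<dots> \<le> 32 * 1" using \<open>s \<le> (real J)\<^sup>2\<close> J(3) by (intro mult_left_mono) auto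
      finally show ?thesis by simp
    qed
    have tu: "\<kappa> \<le> 2 * (e * s) * u"
    proof -
      have "sqrt s0 * (sqrt s + 2) \<le> sqrt s * (sqrt s0 + 2)" using sq by (simp add: algebra_simps)
      moreover have "sqrt s0 + 2 > 0" "sqrt s + 2 > 0" using sq by linarith+
      ultimately have "sqrt s0 / (sqrt s0 + 2) \<le> sqrt s / (sqrt s + 2)"
        by (simp only: pos_divide_le_eq pos_le_divide_eq times_divide_eq_left)
      also have "\<dots> \<le> sqrt s / real J" using J sq by (intro divide_left_mono) auto
      finally have "(sqrt s0 / (sqrt s0 + 2))\<^sup>2 \<le> (sqrt s / real J)\<^sup>2" using sq by (intro power_mono) auto
      also have "\<dots> = s * (1 / real J)\<^sup>2" using s s0 by (simp add: power_divide)
      finally have "\<kappa> \<le> 4 * e * (s * (1 / real J)\<^sup>2)" unfolding \<kappa>_def using e by (intro mult_left_mono) auto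
      also have "\<dots> = 2 * (e * s) * (2 * (1 / real J)\<^sup>2)" by simp
      also have "\<dots> \<le> 2 * (e * s) * u"
        using \<open>2 * (1 / real J)\<^sup>2 \<le> u\<close> e s s0 by (intro mult_left_mono) auto
      finally show ?thesis .
    qed
    have "g \<le> exp (- 2 * s * u) * (1 - exp (- 2 * (e * s) * u)) / 4"
      unfolding g_def using su tu \<open>\<kappa> > 0\<close>
      by (intro divide_right_mono mult_mono) auto
    moreover have "walk_entropy w \<infinity> s + exp (- 2 * s * u) * (1 - exp (- 2 * (e * s) * u)) / 4
        \<le> walk_entropy w \<infinity> (s + e * s)"
      unfolding u_def using J(3) e s s0 by (intro walk_entropy_infinity_increment) auto
    moreover have "s + e * s = (1 + e) * s" by (simp add: algebra_simps)
    ultimately show ?thesis by simp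
  qed
  ultimately show thesis by (rule that)
qed

lemma walk_entropy_long_time:
  assumes c: "0 < c"
  obtains S where "S > 0"
    "\<And>L t. 2 \<le> L \<Longrightarrow> L < M \<Longrightarrow> S \<le> t \<Longrightarrow> (1 - c) * ln (real L) \<le> walk_entropy w (enat L) t"
proof -
  have "\<forall>\<^sub>F t in at_top. (1 - c) * ln (real L) < walk_entropy w (enat L) t" if "L \<ge> 2" for L
    using that c by (intro walk_entropy_eventually_gt) (auto simp: left_diff_distrib)
  then have "\<forall>\<^sub>F t in at_top. \<forall>L\<in>{2..<M}. (1 - c) * ln (real L) < walk_entropy w (enat L) t"
    by (intro eventually_ball_finite) auto
  then obtain S where S: "\<And>t. t \<ge> S \<Longrightarrow> \<forall>L\<in>{2..<M}. (1 - c) * ln (real L) < walk_entropy w (enat L) t"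
    by (auto simp: eventually_at_top_linorder)
  show thesis
    by (rule that[of "max S 1"]) (use S in \<open>auto intro: less_imp_le\<close>)
qed

text \<open>
  The constants are chosen in the order \<open>s0\<close> (short times), \<open>g\<close> (gap on the integers), \<open>A\<close> (cycles longer
  than \<open>A sqrt t\<close> lose at most \<open>g\<close>), \<open>C\<close> (deficit of the shorter ones), \<open>M\<close> (cycles of length at least \<open>M\<close>
  have \<open>C \<le> c ln L\<close>), \<open>S\<close> (equilibration time of the cycles below \<open>M\<close>). The third level is needed only
  for \<open>L < M\<close> and times between \<open>s0\<close> and \<open>S\<close>, where \<open>\<eta>\<close> puts it below the least of finitely many
  positive entropies.
\<close>

proposition walk_entropy_comparison:
  assumes e: "e > 0" and c: "0 < c"
  obtains \<eta> where "\<eta> > 0"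
    "\<And>L s. L \<ge> 2 \<Longrightarrow> s > 0 \<Longrightarrow>
      min (walk_entropy w \<infinity> s) (min ((1 - c) * ln (real L)) (\<eta> * walk_entropy w \<infinity> s * ln (real L)))
        \<le> walk_entropy w (enat L) ((1 + e) * s)"
proof -
  obtain s0 where s0: "s0 > 0"
    and small: "\<And>w L s. 0 < s \<Longrightarrow> s \<le> s0 \<Longrightarrow> L \<ge> 2 \<Longrightarrow> walk_entropy w \<infinity> s \<le> walk_entropy w (enat L) ((1 + e) * s)"
    using walk_entropy_short_time[OF e] by blast
  obtain g where g: "g > 0"
    and gap: "\<And>w s. s \<ge> s0 \<Longrightarrow> walk_entropy w \<infinity> s + g \<le> walk_entropy w \<infinity> ((1 + e) * s)"
    using walk_entropy_infinity_gap[OF e s0] by blast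
  obtain A where A: "A > 0"
    and close: "\<And>w L s. s \<ge> 0 \<Longrightarrow> L \<ge> 4 \<Longrightarrow> real L \<ge> A * sqrt s \<Longrightarrow> walk_entropy w \<infinity> s \<le> walk_entropy w (enat L) s + g"
    using walk_entropy_infinity_le_cycle[OF g] by blast
  obtain C where C: "C \<ge> 0"
    and diff: "\<And>w L t. t \<ge> 0 \<Longrightarrow> L > 0 \<Longrightarrow> real L \<le> A * sqrt t \<Longrightarrow> ln (real L) - C \<le> walk_entropy w (enat L) t"
    using walk_entropy_diffusive_ge[OF A] by blast
  define M where "M = nat \<lceil>exp (C / c)\<rceil> + 4"
  obtain S where S: "S > 0"
    and cyc: "\<And>L t. 2 \<le> L \<Longrightarrow> L < M \<Longrightarrow> S \<le> t \<Longrightarrow> (1 - c) * ln (real L) \<le> walk_entropy w (enat L) t"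
    using walk_entropy_long_time[OF c, where w=w and M=M] by blast
  define m where "m = Min ((\<lambda>L. walk_entropy w (enat L) s0) ` {2..<M})"
  have M4: "M \<ge> 4" by (simp add: M_def)
  have m_le: "m \<le> walk_entropy w (enat L) s0" if "2 \<le> L" "L < M" for L
    unfolding m_def using that by (intro Min_le) auto
  have enat2: "enat L \<ge> 2" if "L \<ge> 2" for L using that by (simp add: numeral_eq_enat)
  have "m > 0"
  proof -
    have "walk_entropy w (enat L) s0 > 0" if "L \<ge> 2" for L
      using walk_entropy_strict_mono[OF enat2[OF that] _ s0, of w] by simp
    then show ?thesis unfolding m_def using M4 by (subst Min_gr_iff) auto
  qed
  define D where "D = walk_entropy w \<infinity> S * ln (real M)"
  have HS: "walk_entropy w \<infinity> S > 0"
    using walk_entropy_strict_mono[of \<infinity> 0 S w] S by simp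
  have "D > 0" using HS M4 by (simp add: D_def)
  define \<eta> where "\<eta> = m / D"
  have \<eta>: "\<eta> > 0" using \<open>m > 0\<close> \<open>D > 0\<close> by (simp add: \<eta>_def)
  moreover have "min (walk_entropy w \<infinity> s) (min ((1 - c) * ln (real L)) (\<eta> * walk_entropy w \<infinity> s * ln (real L)))
        \<le> walk_entropy w (enat L) ((1 + e) * s)" if L: "L \<ge> 2" and s: "s > 0" for L s
  proof -
    define t where "t = (1 + e) * s"
    have ts: "s \<le> t" using e s by (simp add: t_def)
    consider "s \<le> s0" | "s \<ge> s0" "L < M" "S \<le> t" | "s \<ge> s0" "L < M" "t \<le> S"
      | "s \<ge> s0" "L \<ge> M" "real L \<ge> A * sqrt t" | "s \<ge> s0" "L \<ge> M" "real L \<le> A * sqrt t" by linarith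
    then show ?thesis
    proof cases
      case 1
      from small[OF s 1 L, of w] show ?thesis by simp
    next
      case 2
      from cyc[OF L 2(2,3)] show ?thesis by (simp add: t_def min.coboundedI1 min.coboundedI2)
    next
      case 3
      have "\<eta> * walk_entropy w \<infinity> s * ln (real L) \<le> \<eta> * walk_entropy w \<infinity> S * ln (real M)"
        using 3 \<eta> HS s ts L M4 walk_entropy_mono[of \<infinity> s S w] walk_entropy_mono[of \<infinity> 0 s w]
        by (intro mult_mono mult_nonneg_nonneg) auto
      also have "\<dots> = m" 
      proof -
        have "\<eta> * D = m" using \<open>D > 0\<close> by (simp add: \<eta>_def)
        then show ?thesis by (simp only: D_def mult.assoc)
      qed
      also have "\<dots> \<le> walk_entropy w (enat L) s0" by (rule m_le[OF L 3(2)])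
      also have "\<dots> \<le> walk_entropy w (enat L) t"
        using 3 s0 ts by (intro walk_entropy_mono enat2 L) auto
      finally show ?thesis by (simp add: t_def min.coboundedI2)
    next
      case 4
      have "walk_entropy w \<infinity> s + g \<le> walk_entropy w \<infinity> t" unfolding t_def by (rule gap[OF 4(1)])
      also have "\<dots> \<le> walk_entropy w (enat L) t + g"
        using 4 M4 s ts by (intro close) auto
      finally show ?thesis by (simp add: t_def min.coboundedI1)
    next
      case 5
      have "exp (C / c) \<le> real L" using 5(2) unfolding M_def by linarith
      then have "C / c \<le> ln (real L)" using L by (simp add: ln_ge_iff)
      then have "C \<le> c * ln (real L)" using c by (simp add: field_simps)
      moreover have "ln (real L) - C \<le> walk_entropy w (enat L) t"
        using 5 s ts L by (intro diff) auto
      ultimately have "(1 - c) * ln (real L) \<le> walk_entropy w (enat L) t"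
        by (simp add: left_diff_distrib)
      then show ?thesis by (simp add: t_def min.coboundedI1 min.coboundedI2)
    qed
  qed
  ultimately show thesis by (rule that)
qed

section \<open>Quotients by multiples\<close>

lemma (in comm_group) subgroup_multiples: "subgroup (multiples L G) G"
proof (rule subgroupI)
  show "multiples L G \<subseteq> carrier G" by (auto simp: multiples_def)
  show "multiples L G \<noteq> {}" by (auto simp: multiples_def)
next
  fix a assume "a \<in> multiples L G"
  then obtain x where x: "x \<in> carrier G" "a = x [^] L" by (auto simp: multiples_def)
  then have "inv a = (inv x) [^] L" by (simp add: nat_pow_inv)
  with x show "inv a \<in> multiples L G" by (auto simp: multiples_def)
next
  fix a b assume "a \<in> multiples L G" "b \<in> multiples L G"
  then obtain x y where "x \<in> carrier G" "a = x [^] L" "y \<in> carrier G" "b = y [^] L"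
    by (auto simp: multiples_def)
  then have "a \<otimes> b = (x \<otimes> y) [^] L" "x \<otimes> y \<in> carrier G" by (simp_all add: nat_pow_distrib)
  then show "a \<otimes> b \<in> multiples L G" by (auto simp: multiples_def)
qed

lemma (in comm_group) finprod_int_pow_closed:
  "S \<subseteq> carrier G \<Longrightarrow> (\<Otimes>g\<in>S. g [^] (a g :: int)) \<in> carrier G"
  by (intro finprod_closed) auto

lemma (in comm_group) generate_imp_finprod:
  assumes S: "S \<subseteq> carrier G" "finite S" and x: "x \<in> generate G S"
  shows "\<exists>a. x = (\<Otimes>g\<in>S. g [^] (a g :: int))"
  using x
proof induction
  case one
  have "\<one> = (\<Otimes>g\<in>S. g [^] (0 :: int))" by (simp add: finprod_one_eqI)
  then show ?case by (intro exI[of _ "\<lambda>g. 0"])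
next
  case (incl h)
  have "(\<Otimes>g\<in>S. g [^] (if g = h then 1 else 0 :: int)) = (\<Otimes>g\<in>S. if g = h then g [^] (1 :: int) else \<one>)"
    by (rule finprod_cong') (use S in auto)
  also have "\<dots> = h [^] (1 :: int)"
    by (rule finprod_singleton_swap) (use S incl in auto)
  also have "\<dots> = h" using S incl by (auto simp: int_pow_1)
  finally show ?case by metis
next
  case (inv h)
  have "(\<Otimes>g\<in>S. g [^] (if g = h then - 1 else 0 :: int)) = (\<Otimes>g\<in>S. if g = h then g [^] (- 1 :: int) else \<one>)"
    by (rule finprod_cong') (use S in auto)
  also have "\<dots> = h [^] (- 1 :: int)"
    by (rule finprod_singleton_swap) (use S inv in auto)
  also have "\<dots> = inv h" using S inv by (auto simp: int_pow_neg int_pow_1)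
  finally show ?case by metis
next
  case (eng h1 h2)
  then obtain a b where "h1 = (\<Otimes>g\<in>S. g [^] (a g :: int))" "h2 = (\<Otimes>g\<in>S. g [^] (b g :: int))" by auto
  then have "h1 \<otimes> h2 = (\<Otimes>g\<in>S. g [^] (a g) \<otimes> g [^] (b g))"
    using S by (simp add: finprod_multf Pi_def subset_iff)
  also have "\<dots> = (\<Otimes>g\<in>S. g [^] (a g + b g))"
    by (rule finprod_cong') (use S in \<open>auto simp: int_pow_mult\<close>)
  finally show ?case by (intro exI[of _ "\<lambda>g. a g + b g"])
qed

lemma (in comm_group) finprod_mem_subgroup:
  assumes H: "subgroup H G" and f: "\<And>g. g \<in> S \<Longrightarrow> f g \<in> H"
  shows "finprod G f S \<in> H"
proof (cases "finite S")
  case True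
  then show ?thesis using f
  proof induction
    case empty
    show ?case using subgroup.one_closed[OF H] by simp
  next
    case (insert g S)
    then have "f \<in> S \<rightarrow> carrier G" "f g \<in> carrier G"
      using subgroup.subset[OF H] by auto
    with insert show ?case using subgroup.m_closed[OF H] by simp
  qed
qed (use subgroup.one_closed[OF H] in simp)

text \<open>
  Modulo \<open>L G\<close> the exponents in a product of generators can be reduced to \<open>0, ..., L - 1\<close>.
\<close>

lemma (in comm_group) order_quotient_le_power:
  assumes S: "S \<subseteq> carrier G" "finite S" "generate G S = carrier G" and L: "L > 0"
  shows "order (G Mod multiples L G) \<le> L ^ card S"
proof -
  let ?H = "multiples L G"
  let ?F = "\<lambda>a. \<Otimes>g\<in>S. g [^] (a g :: int)"
  let ?E = "S \<rightarrow>\<^sub>E {0..<int L}"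
  have "rcosets ?H \<subseteq> (\<lambda>a. ?H #> ?F a) ` ?E"
  proof
    fix c assume "c \<in> rcosets ?H"
    then obtain x where x: "x \<in> carrier G" "c = ?H #> x" by (auto simp: RCOSETS_def)
    then obtain b where b: "x = ?F b" using generate_imp_finprod[OF S(1,2)] S(3) by metis
    define a where "a = restrict (\<lambda>g. b g mod int L) S"
    have a: "a \<in> ?E" using L by (auto simp: a_def)
    \<comment> \<open>The part of the exponents divisible by \<open>L\<close> contributes an element of \<open>L G\<close>.\<close>
    define z where "z = (\<Otimes>g\<in>S. g [^] (b g div int L * int L))"
    have pow: "g [^] (b g div int L * int L) = (g [^] (b g div int L)) [^] L" if "g \<in> S" for g
    proof -
      have "g \<in> carrier G" using that S by auto
      then show ?thesis by (simp add: int_pow_pow[symmetric] int_pow_int)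
    qed
    have "z \<in> ?H"
      unfolding z_def
      by (rule finprod_mem_subgroup[OF subgroup_multiples]) (use pow S in \<open>auto simp: multiples_def\<close>)
    have "x = (\<Otimes>g\<in>S. g [^] (b g div int L * int L) \<otimes> g [^] (a g))"
      unfolding b by (rule finprod_cong') (use S in \<open>auto simp: a_def simp flip: int_pow_mult\<close>)
    also have "\<dots> = z \<otimes> ?F a"
      unfolding z_def using S by (intro finprod_multf) auto
    finally have "x \<in> ?H #> ?F a" using \<open>z \<in> ?H\<close> by (auto simp: r_coset_def)
    from repr_independence[OF this finprod_int_pow_closed[OF S(1)] subgroup_multiples] x(2)
    have "c = ?H #> ?F a" by simp
    with a show "c \<in> (\<lambda>a. ?H #> ?F a) ` ?E" by blast
  qed
  moreover have fin: "finite ?E" using S by (intro finite_PiE) auto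
  ultimately have "card (rcosets ?H) \<le> card ?E"
    by (meson card_image_le card_mono finite_imageI order_trans)
  also have "card ?E = L ^ card S" using S by (simp add: card_PiE)
  finally show ?thesis by (simp add: order_def FactGroup_def)
qed

text \<open>
  By Bezout's identity, as the order of \<open>G\<close> annihilates \<open>G\<close>.
\<close>

lemma (in comm_group) multiples_gcd:
  assumes "finite (carrier G)" and L: "L > 0"
  shows "multiples L G = multiples (gcd L (order G)) G"
proof (rule antisym)
  obtain c where c: "L = gcd L (order G) * c" by (rule dvdE[OF gcd_dvd1])
  have "x [^] L = (x [^] c) [^] gcd L (order G)" if "x \<in> carrier G" for x
    using that c by (simp add: nat_pow_pow mult.commute)
  then show "multiples L G \<subseteq> multiples (gcd L (order G)) G" by (auto simp: multiples_def)
  obtain u v where uv: "L * u = order G * v + gcd L (order G)"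
    using bezout_nat[of L "order G"] L by auto
  have "x [^] gcd L (order G) = (x [^] u) [^] L" if x: "x \<in> carrier G" for x
  proof -
    have "(x [^] u) [^] L = x [^] (order G * v + gcd L (order G))"
      using x uv by (simp add: nat_pow_pow mult.commute)
    also have "\<dots> = (x [^] order G) [^] v \<otimes> x [^] gcd L (order G)"
      using x by (simp add: nat_pow_pow flip: nat_pow_mult)
    finally show ?thesis using x by (simp add: pow_order_eq_1)
  qed
  then show "multiples (gcd L (order G)) G \<subseteq> multiples L G" by (auto simp: multiples_def)
qed

lemma (in comm_group) order_quotient_multiples:
  assumes fin: "finite (carrier G)"
  shows "0 < order (G Mod multiples L G)" "order (G Mod multiples L G) \<le> order G"
    and "order (G Mod multiples 1 G) = 1" "order (G Mod multiples (order G) G) = order G"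
proof -
  have lag: "card (rcosets (multiples l G)) * card (multiples l G) = order G" for l
    by (rule lagrange[OF subgroup_multiples])
  have oG: "order G > 0" using fin by (simp add: order_gt_0_iff_finite)
  have ord: "order (G Mod multiples l G) = card (rcosets (multiples l G))" for l
    by (simp add: order_def FactGroup_def)
  show "0 < order (G Mod multiples L G)" "order (G Mod multiples L G) \<le> order G"
    using lag[of L] oG unfolding ord by (metis gr0I mult_is_0, metis dvd_imp_le dvd_triv_left)
  have "multiples 1 G = carrier G" by (auto simp: multiples_def image_iff)
  then show "order (G Mod multiples 1 G) = 1"
    using lag[of 1] oG unfolding ord by (simp add: order_def)
  have "multiples (order G) G = {\<one>}"
    using pow_order_eq_1 by (auto simp: multiples_def image_iff)
  then show "order (G Mod multiples (order G) G) = order G"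
    using lag[of "order G"] unfolding ord by simp
qed

lemma min_generators_obtain:
  assumes "group G" "finite (carrier G)"
  obtains S where "S \<subseteq> carrier G" "finite S" "card S = min_generators G" "generate G S = carrier G"
proof -
  have "generate G (carrier G) = carrier G"
    using group.generate_incl[OF assms(1), of "carrier G"] generate.incl[of _ "carrier G" G] by auto
  then have "\<exists>m S. S \<subseteq> carrier G \<and> finite S \<and> card S = m \<and> generate G S = carrier G"
    using assms(2) by blast
  then have "\<exists>S. S \<subseteq> carrier G \<and> finite S \<and> card S = min_generators G \<and> generate G S = carrier G"
    unfolding min_generators_def by (rule LeastI_ex)
  then show thesis using that by blast
qed

section \<open>The maximal entropic time\<close>

text \<open>
  Times are compared through entropies: since the entropy is strictly increasing, a time with
  \<open>H\<^sub>L(t) = y\<close> is at most \<open>(1 + e) s\<close> once \<open>H\<^sub>L((1 + e) s) \<ge> y\<close>. Strict monotonicity also makes the value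
  of the inverse function well determined.
\<close>

lemma max_entropic_time:
  fixes w :: walk and N :: "nat \<Rightarrow> nat" and k n d :: nat and e c \<eta> :: real
  defines "f \<equiv> \<lambda>L. entropic_time w k (enat L) (N L)" and "T \<equiv> entropic_time w k \<infinity> n"
  assumes k: "k > 0" and n: "n \<ge> 2" and c: "0 < c" and e: "e > 0"
    and N_pos: "\<And>L. 0 < N L" and N_le: "\<And>L. N L \<le> n" and N_pow: "\<And>L. 0 < L \<Longrightarrow> N L \<le> L ^ d"
    and N_gcd: "\<And>L. 0 < L \<Longrightarrow> N L = N (gcd L n)" and N_1: "N 1 = 1" and N_n: "N n = n"
    and dk: "real d \<le> (1 - c) * real k" and dn: "real d \<le> \<eta> * ln (real n)"
    and comparison: "\<And>L s. L \<ge> 2 \<Longrightarrow> s > 0 \<Longrightarrow>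
      min (walk_entropy w \<infinity> s) (min ((1 - c) * ln (real L)) (\<eta> * walk_entropy w \<infinity> s * ln (real L)))
        \<le> walk_entropy w (enat L) ((1 + e) * s)"
  shows "T > 0" and "\<exists>L. is_arg_max f (\<lambda>L. 1 \<le> L) L \<and> T \<le> f L \<and> f L \<le> (1 + e) * T"
proof -
  define x where "x = ln (real n) / real k"
  define y where "y L = ln (real (N L)) / real k" for L
  define inf where "inf = inv_into {0..} (walk_entropy w \<infinity>) x"
  define r where "r L = inv_into {0..} (walk_entropy w (enat L)) (y L)" for L
  have "x > 0" using n k by (simp add: x_def)
  have T: "T = k * inf"
    by (simp add: T_def entropic_time_def inf_def x_def)
  have f: "f L = k * r L" if "L \<ge> 2" for L
    using that by (simp add: f_def entropic_time_def r_def y_def one_enat_def)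
  have f1: "f 1 = 0" by (simp add: f_def entropic_time_def one_enat_def)
  have inf: "inf \<ge> 0" "walk_entropy w \<infinity> inf = x"
    unfolding inf_def using \<open>x > 0\<close> by (intro inv_walk_entropy; simp)+
  have inf_pos: "inf > 0" using inf \<open>x > 0\<close> by (cases "inf = 0") auto
  then show "T > 0" using k by (simp add: T)
  have y0: "y L \<ge> 0" for L using N_pos[of L] by (simp add: y_def)
  have yx: "y L \<le> x" for L
    unfolding y_def x_def using N_pos[of L] N_le[of L] by (intro divide_right_mono ln_mono) auto
  have yd: "y L \<le> real d * ln (real L) / real k" if "L > 0" for L
  proof -
    have "ln (real (N L)) \<le> ln (real (L ^ d))"
      using N_pos[of L] N_pow[OF that] by (intro ln_mono) auto
    also have "\<dots> = real d * ln (real L)" using that by (simp add: ln_realpow)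
    finally show ?thesis unfolding y_def by (rule divide_right_mono) simp
  qed
  have yc: "y L \<le> (1 - c) * ln (real L)" if "L \<ge> 2" for L
  proof -
    have "real d * ln (real L) \<le> (1 - c) * real k * ln (real L)"
      using dk that by (intro mult_right_mono) auto
    then have "real d * ln (real L) / real k \<le> (1 - c) * ln (real L)"
      using k by (simp add: field_simps)
    with yd[of L] that show ?thesis by simp
  qed
  have y_eta: "y L \<le> \<eta> * x * ln (real L)" if "L \<ge> 2" for L
  proof -
    have "real d * ln (real L) \<le> \<eta> * ln (real n) * ln (real L)"
      using dn that by (intro mult_right_mono) auto
    then have "real d * ln (real L) / real k \<le> \<eta> * ln (real n) * ln (real L) / real k"
      by (rule divide_right_mono) simp
    with yd[of L] that show ?thesis by (simp add: x_def)
  qed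
  have yL: "y L < ln (real L)" if "L \<ge> 2" for L
  proof -
    have "c * ln (real L) > 0" using c that by simp
    with yc[OF that] show ?thesis by (simp add: left_diff_distrib)
  qed
  have r: "r L \<ge> 0" "walk_entropy w (enat L) (r L) = y L" if "L \<ge> 2" for L
    unfolding r_def using that y0 yL[OF that] by (intro inv_walk_entropy; auto)+
  have enat2: "enat L \<ge> 2" if "L \<ge> 2" for L using that by (simp add: numeral_eq_enat)
  have upper: "f L \<le> (1 + e) * T" if "L \<ge> 1" for L
  proof (cases "L = 1")
    case True
    then show ?thesis using \<open>T > 0\<close> e f1 by simp
  next
    case False
    with that have L: "L \<ge> 2" by simp
    have "y L \<le> walk_entropy w (enat L) ((1 + e) * inf)"
      using comparison[OF L inf_pos] yx[of L] yc[OF L] y_eta[OF L] unfolding inf(2) by linarith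
    then have "r L \<le> (1 + e) * inf"
      using walk_entropy_le_iff[OF enat2[OF L] r(1)[OF L], of "(1 + e) * inf" w] inf(1) e r(2)[OF L] by simp
    then have "real k * r L \<le> real k * ((1 + e) * inf)" by (rule mult_left_mono) simp
    then show ?thesis unfolding f[OF L] T by (simp add: mult.left_commute)
  qed
  have reduce: "f L \<le> f (gcd L n)" if "L \<ge> 1" for L
  proof (cases "L = 1")
    case False
    with that have L: "L \<ge> 2" by simp
    have "y L = y (gcd L n)" unfolding y_def using N_gcd[of L] that by simp
    have "gcd L n > 0" using that by simp
    then consider "gcd L n = 1" | "gcd L n \<ge> 2" by linarith
    then show ?thesis
    proof cases
      case 1
      have "y (gcd L n) = 0" unfolding 1 y_def N_1 by simp
      then have "walk_entropy w (enat L) (r L) = walk_entropy w (enat L) 0"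
        using r(2)[OF L] \<open>y L = y (gcd L n)\<close> by simp
      then have "r L \<le> 0"
        using walk_entropy_le_iff[OF enat2[OF L] r(1)[OF L], of 0 w] by simp
      then show ?thesis using f1 f[OF L] 1 by (simp add: mult_nonneg_nonpos)
    next
      case 2
      have "walk_entropy w (enat L) (r L) = walk_entropy w (enat (gcd L n)) (r (gcd L n))"
        using r(2)[OF L] r(2)[OF 2] \<open>y L = y (gcd L n)\<close> by simp
      also have "\<dots> \<le> walk_entropy w (enat L) (r (gcd L n))"
        using that by (intro walk_entropy_dvd_le) auto
      finally have "r L \<le> r (gcd L n)"
        using walk_entropy_le_iff[OF enat2[OF L] r(1)[OF L] r(1)[OF 2], of w] by simp
      then show ?thesis unfolding f[OF L] f[OF 2] by (intro mult_left_mono) auto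
    qed
  qed simp
  let ?D = "{L. L dvd n}"
  have D: "finite ?D" "n \<in> ?D" using n by auto
  obtain L where LD: "L dvd n" and Lmax: "\<And>L'. L' dvd n \<Longrightarrow> f L' \<le> f L"
  proof -
    have "Max (f ` ?D) \<in> f ` ?D" using D by (intro Max_in) auto
    then obtain L where "L \<in> ?D" "f L = Max (f ` ?D)" by auto
    moreover have "f L' \<le> Max (f ` ?D)" if "L' dvd n" for L'
      using D that by (intro Max_ge) auto
    ultimately show thesis using that by auto
  qed
  have L1: "L \<ge> 1" using LD n by (cases L) auto
  have max: "f L' \<le> f L" if "L' \<ge> 1" for L'
    using reduce[OF that] Lmax[of "gcd L' n"] by simp
  have "inf \<le> r n"
  proof -
    have "walk_entropy w (enat n) inf \<le> walk_entropy w \<infinity> inf"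
      using n inf(1) by (intro walk_entropy_le_infinity) auto
    also have "\<dots> = walk_entropy w (enat n) (r n)"
      using r(2)[OF n] by (simp add: inf(2) y_def x_def N_n)
    finally show ?thesis
      using walk_entropy_le_iff[OF enat2[OF n] inf(1) r(1)[OF n], of w] by simp
  qed
  then have "T \<le> f n" unfolding T f[OF n] by (intro mult_left_mono) auto
  also have "\<dots> \<le> f L" using max[of n] n by simp
  finally have "T \<le> f L" .
  moreover have "is_arg_max f (\<lambda>L. 1 \<le> L) L"
    using L1 max by (auto simp: is_arg_max_def not_less)
  ultimately show "\<exists>L. is_arg_max f (\<lambda>L. 1 \<le> L) L \<and> T \<le> f L \<and> f L \<le> (1 + e) * T"
    using upper[OF L1] by blast
qed

theorem propositionB18:
  fixes w :: walk and d n k :: "nat \<Rightarrow> nat"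
  assumes "filterlim n at_top sequentially"
    and "(\<lambda>j. real (d j) / ln (real (n j))) \<longlonglongrightarrow> 0"
    and "same_order (\<lambda>j. real (k j) - real (d j)) (\<lambda>j. real (k j))"
  shows "\<forall>\<epsilon>>0. \<forall>\<^sub>F j in sequentially. \<forall>G :: 'a monoid.
    comm_group G \<and> finite (carrier G) \<and> order G = n j \<and> min_generators G = d j \<longrightarrow>
    (\<exists>L. is_arg_max (\<lambda>L. entropic_time w (k j) (enat L) (order (G Mod multiples L G)))
            (\<lambda>L. 1 \<le> L) L \<and>
         \<bar>entropic_time w (k j) (enat L) (order (G Mod multiples L G))
            / entropic_time w (k j) \<infinity> (order G) - 1\<bar> < \<epsilon>)"
proof (intro allI impI)
  fix \<epsilon> :: real assume "\<epsilon> > 0"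
  then have e: "\<epsilon> / 2 > 0" by simp
  obtain c C where c: "c > 0" and cC: "\<forall>\<^sub>F j in sequentially.
      c \<le> (real (k j) - real (d j)) / real (k j) \<and> (real (k j) - real (d j)) / real (k j) \<le> C"
    using assms(3) unfolding same_order_def by blast
  from cC have ck: "\<forall>\<^sub>F j in sequentially. c \<le> (real (k j) - real (d j)) / real (k j)"
    by eventually_elim simp
  obtain \<eta> where \<eta>: "\<eta> > 0"
    and comparison: "\<And>L s. L \<ge> 2 \<Longrightarrow> s > 0 \<Longrightarrow>
      min (walk_entropy w \<infinity> s) (min ((1 - c) * ln (real L)) (\<eta> * walk_entropy w \<infinity> s * ln (real L)))
        \<le> walk_entropy w (enat L) ((1 + \<epsilon> / 2) * s)"
    using walk_entropy_comparison[OF e c, where w=w] by blast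
  have "\<forall>\<^sub>F j in sequentially. n j \<ge> 2"
    using assms(1) by (auto simp: filterlim_at_top)
  moreover have "\<forall>\<^sub>F j in sequentially. real (d j) / ln (real (n j)) < \<eta>"
    using assms(2) \<eta> by (rule order_tendstoD(2))
  ultimately show "\<forall>\<^sub>F j in sequentially. \<forall>G :: 'a monoid.
    comm_group G \<and> finite (carrier G) \<and> order G = n j \<and> min_generators G = d j \<longrightarrow>
    (\<exists>L. is_arg_max (\<lambda>L. entropic_time w (k j) (enat L) (order (G Mod multiples L G)))
            (\<lambda>L. 1 \<le> L) L \<and>
         \<bar>entropic_time w (k j) (enat L) (order (G Mod multiples L G))
            / entropic_time w (k j) \<infinity> (order G) - 1\<bar> < \<epsilon>)"
    using ck
  proof eventually_elim
    case (elim j)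
    \<comment> \<open>A vanishing \<open>k j\<close> would make the quotient 0 and contradict the lower bound \<open>c\<close>.\<close>
    have "k j > 0" using elim(3) c by (cases "k j = 0") auto
    then have dk: "real (d j) \<le> (1 - c) * real (k j)" using elim(3) by (simp add: field_simps)
    have dn: "real (d j) \<le> \<eta> * ln (real (n j))" using elim(1,2) by (simp add: field_simps)
    show ?case
    proof (intro allI impI, elim conjE)
      fix G :: "'a monoid"
      assume G: "comm_group G" "finite (carrier G)" "order G = n j" "min_generators G = d j"
      interpret comm_group G by (rule G(1))
      obtain S where S: "S \<subseteq> carrier G" "finite S" "card S = min_generators G" "generate G S = carrier G"
        using min_generators_obtain[OF is_group G(2)] by blast
      let ?N = "\<lambda>L. order (G Mod multiples L G)"
      let ?T = "entropic_time w (k j) \<infinity> (n j)"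
      have "?N L \<le> L ^ d j" if "0 < L" for L
        using order_quotient_le_power[OF S(1,2,4) that] unfolding S(3) G(4) .
      moreover have "?N L = ?N (gcd L (n j))" if "0 < L" for L
        using multiples_gcd[OF G(2) that] by (simp add: G(3))
      moreover note order_quotient_multiples[OF G(2), unfolded G(3)]
      ultimately have T: "?T > 0"
        and "\<exists>L. is_arg_max (\<lambda>L. entropic_time w (k j) (enat L) (?N L)) (\<lambda>L. 1 \<le> L) L \<and>
          ?T \<le> entropic_time w (k j) (enat L) (?N L) \<and>
          entropic_time w (k j) (enat L) (?N L) \<le> (1 + \<epsilon> / 2) * ?T"
        using max_entropic_time[of "k j" "n j" c "\<epsilon> / 2" ?N "d j" \<eta> w] \<open>k j > 0\<close> elim(1) c e dk dn comparison
        by (simp_all only:)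
      then obtain L where L: "is_arg_max (\<lambda>L. entropic_time w (k j) (enat L) (?N L)) (\<lambda>L. 1 \<le> L) L"
        and lo: "?T \<le> entropic_time w (k j) (enat L) (?N L)"
        and up: "entropic_time w (k j) (enat L) (?N L) \<le> (1 + \<epsilon> / 2) * ?T" by blast
      have "1 \<le> entropic_time w (k j) (enat L) (?N L) / ?T"
        "entropic_time w (k j) (enat L) (?N L) / ?T \<le> 1 + \<epsilon> / 2"
        using lo up T by (simp_all add: field_simps)
      then have "\<bar>entropic_time w (k j) (enat L) (?N L) / ?T - 1\<bar> < \<epsilon>"
        using \<open>\<epsilon> > 0\<close> by linarith
      with L show "\<exists>L. is_arg_max (\<lambda>L. entropic_time w (k j) (enat L) (?N L)) (\<lambda>L. 1 \<le> L) L \<and>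
         \<bar>entropic_time w (k j) (enat L) (?N L) / entropic_time w (k j) \<infinity> (order G) - 1\<bar> < \<epsilon>"
        unfolding G(3) by blast
    qed
  qed
qed

end
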